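(* Let $\varphi:[0,\infty)\to[0,\infty)$ be a non-increasing function such that, for some $\mu>0$ and $\nu>0$, the function $t\mapsto e^{\nu t}\varphi(t)$ is non-decreasing on $[0,\infty)$, and the integral $\int_0^\infty e^{zt}\,d\varphi(t)$ converges for all $z\in\mathbb{C}$ with $0<\operatorname{Re} z<\mu$. Assume moreover the following. (1) There exist a constant $j>0$ and complex-valued functions $H$, holomorphic on $\{0<\operatorname{Re} z\le\mu\}$, and $F$, holomorphic on $\{0<\operatorname{Re} z<\mu\}$ and continuous on $\{0<\operatorname{Re} z\le\mu\}$, such that $$\int_0^\infty e^{zt}\varphi(t)\,dt=\frac{F(z)}{(\mu-z)^j}+H(z),\qquad 0<\operatorname{Re} z<\mu$$ (in particular the integral on the left converges for these $z$). (2) For every $T>0$, $$\lim_{\sigma\to0+} g_j(\sigma)\sup_{|\tau|\le T}\bigl|F(\mu-2\sigma-i\tau)-F(\mu-\sigma-i\tau)\bigr|=0,$$ where, for $\sigma>0$, $g_j(\sigma)=\sigma^{j-1}$ if $0<j<1$, $g_j(\sigma)=\log\sigma$ if $j=1$, and $g_j(\sigma)=1$ if $j>1$. Then $$\varphi(t)\sim\frac{F(\mu)}{\Gamma(j)}\,t^{j-1}e^{-\mu t},\qquad t\to\infty,$$ that is, $\lim_{t\to\infty}\varphi(t)\,t^{1-j}e^{\mu t}=F(\mu)/\Gamma(j)$.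
   Context: The integral $\int_0^\infty e^{zt}\,d\varphi(t)$ is a (possibly improper) Riemann–Stieltjes integral with respect to the monotone function $\varphi$, and integrals over $[0,\infty)$ are understood as limits of integrals over $[0,R]$ as $R\to\infty$. A function is holomorphic on the non-open set $\{0<\operatorname{Re} z\le\mu\}$ if it is holomorphic on an open neighbourhood of that set. For $\operatorname{Re} z<\mu$, the power $(\mu-z)^j$ is taken with the principal branch. $\Gamma$ is Euler's Gamma function. *)

theory Defs
  imports "HOL-Analysis.Analysis"
begin

text \<open>
  Classical (mesh-based) Riemann--Stieltjes integral over \<open>{a..b}\<close>. Every member \<open>K\<close> of a tagged
  division is a nonempty compact interval \<open>{u..v}\<close>, so \<open>Inf K = u\<close> and \<open>Sup K = v\<close>; one-point
  intervals contribute nothing to the sum.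
\<close>
definition has_RS_integral ::
    "(real \<Rightarrow> 'a::real_normed_vector) \<Rightarrow> (real \<Rightarrow> real) \<Rightarrow> 'a \<Rightarrow> real \<Rightarrow> real \<Rightarrow> bool" where
  "has_RS_integral f \<phi> I a b \<longleftrightarrow>
     (\<forall>e>0. \<exists>d>0. \<forall>p. p tagged_division_of {a..b} \<and> (\<forall>(x, K)\<in>p. diameter K < d) \<longrightarrow>
        norm ((\<Sum>(x, K)\<in>p. (\<phi> (Sup K) - \<phi> (Inf K)) *\<^sub>R f x) - I) < e)"

definition RS_converges_on_halfline ::
    "(real \<Rightarrow> 'a::real_normed_vector) \<Rightarrow> (real \<Rightarrow> real) \<Rightarrow> bool" where
  "RS_converges_on_halfline f \<phi> \<longleftrightarrow>
     (\<exists>J L. (\<forall>R\<ge>0. has_RS_integral f \<phi> (J R) 0 R) \<and> (J \<longlongrightarrow> L) at_top)"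

definition has_halfline_integral :: "(real \<Rightarrow> 'a::real_normed_vector) \<Rightarrow> 'a \<Rightarrow> bool" where
  "has_halfline_integral f L \<longleftrightarrow>
     (\<forall>R\<ge>0. f integrable_on {0..R}) \<and> ((\<lambda>R. integral {0..R} f) \<longlongrightarrow> L) at_top"

definition g_weight :: "real \<Rightarrow> real \<Rightarrow> real" where
  "g_weight j \<sigma> = (if j < 1 then \<sigma> powr (j - 1) else if j = 1 then ln \<sigma> else 1)"

end

theory Submission
  imports Defs "HOL-Complex_Analysis.Complex_Analysis" "HOL-Probability.Sinc_Integral" "HOL-Real_Asymp.Real_Asymp"
begin

text \<open>
  Put \<open>f t = e\<^sup>\<mu>\<^sup>t \<phi> t\<close>, whose Laplace transform is \<open>G s / s\<^sup>j + h s\<close> with \<open>G s = F (\<mu> - s)\<close> and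
  \<open>h s = H (\<mu> - s)\<close>. Weight \<open>f\<close> by \<open>W (t / x)\<close> with \<open>W v = e\<^sup>-\<^sup>v - e\<^sup>-\<^sup>2\<^sup>v\<close> and average it against a
  Fejer kernel of fixed bandwidth \<open>r\<close> centred at \<open>x\<close>. Since the Fejer kernel is the Fourier transform of
  a tent supported in \<open>[-r, r]\<close>, the average is an integral over \<open>\<bar>\<tau>\<bar> \<le> r\<close> of the difference of the
  Laplace transform at \<open>\<sigma> + i\<tau>\<close> and at \<open>2\<sigma> + i\<tau>\<close>, where \<open>\<sigma> = 1 / x\<close>. Subtracting the same average of
  \<open>G 0 t\<^sup>j\<^sup>-\<^sup>1 / \<Gamma> j\<close> replaces \<open>G s\<close> by \<open>G s - G 0\<close>, and writing \<open>s = \<sigma> + i\<tau>\<close>, \<open>s' = 2\<sigma> + i\<tau>\<close>, the difference is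
  \[ (G s - G s') s^{-j} + (G s' - G 0) (s^{-j} - s'^{-j}) + (h s - h s'). \]
  Its integral is \<open>o(\<sigma>\<^sup>1\<^sup>-\<^sup>j)\<close>: the first term by hypothesis (2), whose weight \<open>g\<^sub>j\<close> is exactly
  \<open>\<sigma>\<^sup>j\<^sup>-\<^sup>1 \<integral> \<bar>s\<bar>\<^sup>-\<^sup>j d\<tau>\<close> up to a constant, the second because \<open>\<bar>s\<^sup>-\<^sup>j - s'\<^sup>-\<^sup>j\<bar> \<le> j \<sigma> \<bar>s\<bar>\<^sup>-\<^sup>j\<^sup>-\<^sup>1\<close> concentrates at
  \<open>\<tau> = 0\<close>, and the third because \<open>h\<close> is Lipschitz. So the averages of \<open>f\<close> and of the power function agree
  to leading order for every \<open>r\<close>; letting \<open>r\<close> tend to infinity, the slow oscillation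
  \<open>f t \<le> e\<^bsup>(\<mu>+\<nu>)\<bar>t-x\<bar>\<^esup> f x\<close> transfers this to \<open>f\<close> itself.
\<close>

section \<open>The Fejer kernel\<close>

text \<open>This is the square of sin(y/2)/(y/2), with the removable singularity at 0 filled by its
  limit 1; the cosine form is what the transform of a tent produces directly.\<close>

definition fejer :: "real \<Rightarrow> real" where
  "fejer y = (if y = 0 then 1 else 2 * (1 - cos y) / y\<^sup>2)"

lemma fejer_measurable [measurable]: "fejer \<in> borel_measurable borel"
  unfolding fejer_def by measurable

lemma fejer_nonneg: "0 \<le> fejer y"
  by (simp add: fejer_def)

text \<open>The numerator 2(1 - cos y) is at most y^2 and at most 4. Multiplying it by 1 + y^2 and
  using one bound on each summand gives y^2 + 4 y^2, hence the factor 5 over an integrable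
  majorant.\<close>

lemma fejer_le: "fejer y \<le> 5 * inverse (1 + y\<^sup>2)"
proof (cases "y = 0")
  case True
  then show ?thesis by (simp add: fejer_def)
next
  case False
  have "1 - cos y = 2 * (sin (y / 2))\<^sup>2"
    using cos_double_sin[of "y / 2"] by simp
  moreover have "(sin (y / 2))\<^sup>2 \<le> (y / 2)\<^sup>2"
    using abs_sin_x_le_abs_x[of "y / 2"] by (rule abs_le_square_iff[THEN iffD1])
  ultimately have "2 * (1 - cos y) \<le> y\<^sup>2"
    by (simp add: power_divide)
  moreover have "2 * (1 - cos y) \<le> 4"
    using cos_ge_minus_one[of y] by argo
  moreover have "y\<^sup>2 > 0"
    using False by simp
  ultimately have "2 * (1 - cos y) * (1 + y\<^sup>2) \<le> 5 * y\<^sup>2"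
    using mult_right_mono[of "2 * (1 - cos y)" 4 "y\<^sup>2"] by (simp add: algebra_simps)
  then have "2 * (1 - cos y) / y\<^sup>2 \<le> 5 / (1 + y\<^sup>2)"
    using \<open>y\<^sup>2 > 0\<close> add_pos_pos[OF zero_less_one \<open>y\<^sup>2 > 0\<close>] by (simp add: field_simps)
  then show ?thesis
    using False by (simp add: fejer_def divide_inverse)
qed

lemma fejer_integrable: "integrable lborel fejer"
proof (rule Bochner_Integration.integrable_bound)
  have "einterval (-\<infinity>) \<infinity> = (UNIV :: real set)"
    by (auto simp: einterval_def)
  then show "integrable lborel (\<lambda>y::real. 5 * inverse (1 + y\<^sup>2))"
    using integrable_inverse_1_plus_square by (simp add: set_integrable_def)
  show "AE y in lborel. norm (fejer y) \<le> norm (5 * inverse (1 + y\<^sup>2))"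
    using fejer_le fejer_nonneg by (intro AE_I2) (auto simp: abs_of_nonneg)
qed simp

text \<open>The total mass stays a named constant: it multiplies both sides of every later
  comparison and cancels as soon as it is known to be positive.\<close>

definition fejer_mass :: real where
  "fejer_mass = (\<integral>y. fejer y \<partial>lborel)"

lemma fejer_mass_pos: "0 < fejer_mass"
proof -
  let ?b = "\<lambda>y. indicator {1..2::real} y * ((1 - cos 1) / 2) :: real"
  have "(\<integral>y. ?b y \<partial>lborel) \<le> fejer_mass"
    unfolding fejer_mass_def
  proof (rule integral_mono[OF _ fejer_integrable])
    fix y :: real
    have "(1 - cos 1) / 2 \<le> fejer y" if "y \<in> {1..2}"
    proof -
      have "cos y \<le> cos 1"
        using that pi_gt3 by (intro cos_monotone_0_pi_le) auto
      moreover have "y\<^sup>2 \<le> 4"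
        using that power_mono[of y 2 2] by simp
      moreover have "y\<^sup>2 > 0" using that by simp
      ultimately have "2 * (1 - cos 1) / 4 \<le> 2 * (1 - cos y) / y\<^sup>2"
        by (intro frac_le) auto
      then have "(1 - cos 1) / 2 \<le> 2 * (1 - cos y) / y\<^sup>2"
        by argo
      then show ?thesis using that unfolding fejer_def by simp
    qed
    then show "?b y \<le> fejer y"
      using fejer_nonneg by (auto simp: indicator_def)
  qed simp
  moreover have "cos 1 < (1::real)"
    using cos_monotone_0_pi[of 0 1] pi_gt3 by simp
  ultimately show ?thesis by simp
qed

text \<open>\<open>P\<close> is the antiderivative found by integrating by parts. Each side of a
  tent is affine, so one lemma with slope parameter \<open>e\<close> serves both:
  \<open>e = -1/r\<close> on the left, \<open>e = 1/r\<close> on the right. Frequency 0 makes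
  \<open>P\<close> singular and is treated separately.\<close>

lemma has_integral_half_tent:
  fixes y r a b e :: real
  assumes "a \<le> b" "y \<noteq> 0"
  defines "P \<equiv> \<lambda>t. cis (t * y) * (complex_of_real (1 - e * t) / (\<i> * y) - complex_of_real (e / y\<^sup>2))"
  shows "((\<lambda>t. complex_of_real (1 - e * t) * cis (t * y)) has_integral (P b - P a)) {a..b}"
proof (rule fundamental_theorem_of_calculus[OF assms(1)])
  fix t :: real
  \<comment> \<open>\<open>?Q\<close> extends \<open>P\<close> to a complex variable, so the field
    differentiation rules apply before restricting to the real line.\<close>
  let ?Q = "\<lambda>z. exp (\<i> * z * complex_of_real y) * ((1 - complex_of_real e * z) / (\<i> * complex_of_real y) - complex_of_real (e / y\<^sup>2))"
  have "(?Q has_field_derivative complex_of_real (1 - e * t) * cis (t * y)) (at (complex_of_real t))"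
    by (rule derivative_eq_intros refl | use assms(2) in \<open>simp add: cis_conv_exp field_simps power2_eq_square; fail\<close>)+
  then have "((\<lambda>t. ?Q (complex_of_real t)) has_vector_derivative complex_of_real (1 - e * t) * cis (t * y)) (at t within {a..b})"
    by (rule has_vector_derivative_real_field)
  then show "(P has_vector_derivative complex_of_real (1 - e * t) * cis (t * y)) (at t within {a..b})"
    by (simp add: P_def cis_conv_exp mult.assoc)
qed

lemma has_integral_half_tent_0:
  fixes a b e :: real
  assumes "a \<le> b"
  shows "((\<lambda>t. complex_of_real (1 - e * t)) has_integral
    complex_of_real ((b - e * b\<^sup>2 / 2) - (a - e * a\<^sup>2 / 2))) {a..b}"
proof -
  have "((\<lambda>t. 1 - e * t) has_integral ((b - e * b\<^sup>2 / 2) - (a - e * a\<^sup>2 / 2))) {a..b}"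
    by (intro fundamental_theorem_of_calculus assms)
       (auto intro!: derivative_eq_intros simp: has_real_derivative_iff_has_vector_derivative[symmetric])
  then show ?thesis by (rule has_integral_of_real)
qed

lemma fejer_transform:
  assumes "r > 0"
  shows "(\<integral>t. indicator {-r..r} t *\<^sub>R (complex_of_real (1 - \<bar>t\<bar> / r) * cis (t * y)) \<partial>lborel)
    = complex_of_real (r * fejer (r * y))" (is "?I = _")
proof -
  let ?h = "\<lambda>t. complex_of_real (1 - \<bar>t\<bar> / r) * cis (t * y)"
  have cont: "continuous_on {-r..r} ?h"
    unfolding cis_conv_exp by (intro continuous_intros) (use assms in auto)
  have m: "(\<lambda>t. indicator {-r..r} t *\<^sub>R ?h t) \<in> borel_measurable lborel"
    using borel_measurable_continuous_on_indicator[OF _ cont] by simp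
  \<comment> \<open>The Bochner integral is read as a gauge integral, so that it can be identified
    by uniqueness with the value computed on the two halves by the fundamental theorem.\<close>
  have I: "(?h has_integral ?I) {-r..r}"
    using has_integral_set_lebesgue[OF absolutely_integrable_continuous_real[OF cont]] m
    unfolding set_lebesgue_integral_def by (simp add: integral_completion)
  have split: "(?h has_integral X + Y) {-r..r}"
    if "((\<lambda>t. complex_of_real (1 - (- 1 / r) * t) * cis (t * y)) has_integral X) {-r..0}"
       "((\<lambda>t. complex_of_real (1 - (1 / r) * t) * cis (t * y)) has_integral Y) {0..r}" for X Y
    by (rule has_integral_combine[of _ 0]; (rule has_integral_eq[rotated], rule that)?)
       (use assms in auto)
  have "(?h has_integral complex_of_real (r * fejer (r * y))) {-r..r}"
  proof (cases "y = 0")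
    case True
    have "complex_of_real (r * fejer (r * y)) =
       complex_of_real ((0 - (- 1 / r) * 0\<^sup>2 / 2) - ((-r) - (- 1 / r) * (-r)\<^sup>2 / 2))
     + complex_of_real ((r - (1 / r) * r\<^sup>2 / 2) - (0 - (1 / r) * 0\<^sup>2 / 2))"
      unfolding of_real_add[symmetric] of_real_eq_iff
      using True assms by (simp add: fejer_def power2_eq_square)
    also have "(?h has_integral \<dots>) {-r..r}"
      using has_integral_half_tent_0[of "-r" 0 "-1/r"] has_integral_half_tent_0[of 0 r "1/r"] assms True
      by (intro split) auto
    finally show ?thesis .
  next
    case False
    have "cis (r * y) + cis (- (r * y)) = complex_of_real (2 * cos (r * y))"
      by (simp add: complex_eq_iff)
    then have c: "cis (- (r * y)) = complex_of_real (2 * cos (r * y)) - cis (r * y)"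
      by (simp add: algebra_simps)
    let ?P = "\<lambda>e t. cis (t * y) * (complex_of_real (1 - e * t) / (\<i> * y) - complex_of_real (e / y\<^sup>2))"
    have "complex_of_real (r * fejer (r * y)) = (?P (-1/r) 0 - ?P (-1/r) (-r)) + (?P (1/r) r - ?P (1/r) 0)"
      using False assms by (simp add: c) (simp add: fejer_def field_simps power2_eq_square)
    also have "(?h has_integral \<dots>) {-r..r}"
      by (intro split has_integral_half_tent False) (use assms in auto)
    finally show ?thesis .
  qed
  with I show ?thesis by (rule has_integral_unique)
qed

text \<open>Writing the kernel as the transform of a tent and exchanging integrals moves the average
  to the frequency side, where only frequencies in \<open>{-r..r}\<close> survive. The exchange is
  allowed because the tent is bounded with compact support and \<open>cis\<close> has modulus
  1.\<close>

lemma fejer_fubini: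
  fixes g :: "real \<Rightarrow> complex"
  assumes g: "integrable lborel g" and r: "r > 0"
  shows "(\<integral>t. g t * complex_of_real (r * fejer (r * (x - t))) \<partial>lborel) =
    (\<integral>u. indicator {-r..r} u *\<^sub>R (complex_of_real (1 - \<bar>u\<bar> / r) * cis (u * x) *
       (\<integral>t. g t * cis (- (u * t)) \<partial>lborel)) \<partial>lborel)"
proof -
  let ?k = "\<lambda>u. indicator {-r..r} u * (1 - \<bar>u\<bar> / r)"
  let ?f = "\<lambda>t u. g t * (complex_of_real (?k u) * cis (u * (x - t)))"
  have [measurable]: "g \<in> borel_measurable borel"
    using g by auto
  have [measurable]: "cis \<in> borel_measurable borel"
    by (intro borel_measurable_continuous_onI continuous_on_cis continuous_intros)
  have k: "integrable lborel ?k"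
  proof -
    have "set_integrable lborel {-r..r} (\<lambda>u. 1 - \<bar>u\<bar> / r)"
      using r by (intro borel_integrable_atLeastAtMost' continuous_intros) auto
    then show ?thesis by (simp add: set_integrable_def)
  qed
  have int: "integrable (lborel \<Otimes>\<^sub>M lborel) (case_prod ?f)"
  proof (rule Bochner_Integration.integrable_bound)
    show "integrable (lborel \<Otimes>\<^sub>M lborel) (\<lambda>(t, u). norm (g t) * ?k u)"
    proof (rule lborel_pair.Fubini_integrable)
      show "AE t in lborel. integrable lborel (\<lambda>u. case (t, u) of (t, u) \<Rightarrow> norm (g t) * ?k u)"
        using k by simp
      show "integrable lborel (\<lambda>t. \<integral>u. norm (case (t, u) of (t, u) \<Rightarrow> norm (g t) * ?k u) \<partial>lborel)"
        using g by (simp add: abs_mult)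
    qed simp
    show "AE p in lborel \<Otimes>\<^sub>M lborel. norm (case_prod ?f p) \<le> norm (case p of (t, u) \<Rightarrow> norm (g t) * ?k u)"
      by (intro AE_I2)
         (auto simp: norm_mult abs_mult simp del: of_real_mult of_real_diff of_real_divide)
  qed simp
  have "(\<integral>t. g t * complex_of_real (r * fejer (r * (x - t))) \<partial>lborel) = (\<integral>t. (\<integral>u. ?f t u \<partial>lborel) \<partial>lborel)"
    unfolding fejer_transform[OF r, symmetric]
    by (simp add: scaleR_conv_of_real mult.assoc)
  also have "\<dots> = (\<integral>u. (\<integral>t. ?f t u \<partial>lborel) \<partial>lborel)"
    using lborel_pair.Fubini_integral[OF int] by simp
  also have "\<dots> = (\<integral>u. indicator {-r..r} u *\<^sub>R (complex_of_real (1 - \<bar>u\<bar> / r) * cis (u * x) *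
       (\<integral>t. g t * cis (- (u * t)) \<partial>lborel)) \<partial>lborel)"
  proof (rule Bochner_Integration.integral_cong[OF refl])
    fix u
    have "cis (u * (x - t)) = cis (u * x) * cis (- (u * t))" for t
      by (simp add: cis_mult algebra_simps)
    then have "?f t u = complex_of_real (?k u) * cis (u * x) * (g t * cis (- (u * t)))" for t
      by simp
    then show "(\<integral>t. ?f t u \<partial>lborel) = indicator {-r..r} u *\<^sub>R (complex_of_real (1 - \<bar>u\<bar> / r) * cis (u * x) *
       (\<integral>t. g t * cis (- (u * t)) \<partial>lborel))"
      by (simp only: integral_mult_right_zero scaleR_conv_of_real of_real_mult mult.assoc)
  qed
  finally show ?thesis .
qed

section \<open>The Laplace transform of a power\<close>

lemma has_bochner_integral_Gamma_scaled:
  fixes x a :: real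
  assumes x: "x > 0" and a: "a > 0"
  shows "has_bochner_integral lborel (\<lambda>t. indicator {0..} t * (t powr (x - 1) * exp (- (a * t)))) (Gamma x / a powr x)"
proof -
  let ?f = "\<lambda>t::real. indicator {0..} t * t powr (x - 1) / exp t"
  have 1: "has_bochner_integral lborel ?f (Gamma x)"
    by (rule has_bochner_integral_nn_integral)
       (use Gamma_conv_nn_integral_real[OF x] x in \<open>auto simp: Gamma_real_pos less_imp_le\<close>)
  have "has_bochner_integral lborel (\<lambda>t. ?f (0 + a * t)) (Gamma x /\<^sub>R \<bar>a\<bar>)"
    using lborel_has_bochner_integral_real_affine_iff[of a ?f "Gamma x" 0] 1 a by simp
  then have "has_bochner_integral lborel (\<lambda>t. a powr (1 - x) * ?f (0 + a * t)) (a powr (1 - x) * (Gamma x /\<^sub>R \<bar>a\<bar>))"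
    by (rule has_bochner_integral_mult_right)
  moreover have "a powr (1 - x) * (Gamma x /\<^sub>R \<bar>a\<bar>) = Gamma x / a powr x"
    using a by (simp add: powr_diff field_simps)
  moreover have "(\<lambda>t. a powr (1 - x) * ?f (0 + a * t)) = (\<lambda>t. indicator {0..} t * (t powr (x - 1) * exp (- (a * t))))"
  proof
    fix t
    have "a powr (1 - x) * a powr (x - 1) = 1"
      using a by (simp add: powr_add[symmetric])
    moreover have "(a * t) powr (x - 1) = a powr (x - 1) * t powr (x - 1)" if "t \<ge> 0"
      using a that by (simp add: powr_mult)
    ultimately show "a powr (1 - x) * ?f (0 + a * t) = indicator {0..} t * (t powr (x - 1) * exp (- (a * t)))"
      using a by (auto simp: indicator_def zero_le_mult_iff exp_minus field_simps)
  qed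
  ultimately show ?thesis by simp
qed

lemma laplace_powr:
  fixes x :: real and s :: complex
  assumes x: "x > 0" and s: "Re s > 0"
  shows "integrable lborel (\<lambda>t. indicator {0..} t *\<^sub>R (complex_of_real (t powr (x - 1)) * exp (- (s * complex_of_real t))))"
    and "(\<integral>t. indicator {0..} t *\<^sub>R (complex_of_real (t powr (x - 1)) * exp (- (s * complex_of_real t))) \<partial>lborel)
      = complex_of_real (Gamma x) / s powr complex_of_real x"
proof -
  let ?f = "\<lambda>t. indicator {0..} t *\<^sub>R (complex_of_real (t powr (x - 1)) * exp (- (s * complex_of_real t)))"
  show "integrable lborel ?f"
  proof (rule Bochner_Integration.integrable_bound)
    show "integrable lborel (\<lambda>t. indicator {0..} t * (t powr (x - 1) * exp (- (Re s * t))))"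
      using has_bochner_integral_Gamma_scaled[OF x s] by (rule integrable.intros)
  qed (auto simp: norm_mult indicator_def)
  \<comment> \<open>Expand around a real centre \<open>a\<close> so far to the right that \<open>s\<close> lies in the disc of convergence of the
    binomial series.\<close>
  define a where "a = ((cmod s)\<^sup>2 / Re s + Re s)"
  define q where "q = s / complex_of_real a - 1"
  have a: "a > 0" using s by (simp add: a_def add_nonneg_pos)
  \<comment> \<open>Squaring turns the disc condition into |s|^2 < 2 a Re s, and the chosen
    \<open>a\<close> satisfies a Re s = |s|^2 + (Re s)^2.\<close>
  have "(cmod (s - of_real a))\<^sup>2 < a\<^sup>2"
  proof -
    have "(cmod (s - of_real a))\<^sup>2 = (cmod s)\<^sup>2 - 2 * a * Re s + a\<^sup>2"
      unfolding cmod_power2 by (simp add: power2_eq_square algebra_simps)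
    moreover have "a * Re s = (cmod s)\<^sup>2 + (Re s)\<^sup>2"
      using s by (simp add: a_def power2_eq_square field_simps)
    moreover have "(Re s)\<^sup>2 > 0" "(cmod s)\<^sup>2 \<ge> 0" using s by auto
    ultimately show ?thesis by linarith
  qed
  then have "cmod (s - of_real a) < a"
    by (rule power2_less_imp_less) (use a in simp)
  moreover have "q = (s - of_real a) / of_real a"
    using a by (simp add: q_def field_simps)
  ultimately have q: "cmod q < 1"
    using a by (simp add: norm_divide)
  have sq: "s = of_real a * (1 + q)"
    using a by (simp add: q_def)
  let ?u = "\<lambda>n t. indicator {0..} t * (t powr (x + real n - 1) * exp (- (a * t)))"
  let ?g = "\<lambda>n t. ((- (of_real a * q)) ^ n / fact n) * complex_of_real (?u n t)"
  have u: "has_bochner_integral lborel (?u n) (Gamma (x + real n) / a powr (x + real n))" for n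
    using has_bochner_integral_Gamma_scaled[of "x + real n" a] x a by simp
  have ug: "?g n t = of_real (indicator {0..} t * (t powr (x - 1) * exp (- (a * t)))) * ((- (of_real a * q) * of_real t) ^ n / fact n)"
    if "t \<noteq> 0" for n t
  proof (cases "t > 0")
    case True
    have "t powr (x + real n - 1) = t powr (x - 1) * t ^ n"
      using True by (simp add: powr_add powr_diff powr_realpow)
    then show ?thesis
      unfolding power_mult_distrib[of "- (of_real a * q)" "of_real t"] by simp
  qed (use that in simp)
  have G: "Gamma (x + real n) = pochhammer x n * Gamma x" for n
    using pochhammer_Gamma[of x n] x Gamma_real_pos[OF x] by (auto simp: nonpos_Ints_def field_simps)
  \<comment> \<open>The norms integrate to the terms of the same binomial series evaluated at
    \<open>- cmod q\<close>. Its convergence for \<open>cmod q < 1\<close> is the summability that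
    justifies exchanging sum and integral.\<close>
  have ng: "(\<integral>t. norm (?g n t) \<partial>lborel) = Gamma x / a powr x * (((- x) gchoose n) * (- cmod q) ^ n)" for n
  proof -
    have "(\<integral>t. norm (?g n t) \<partial>lborel) = (\<integral>t. (a * cmod q) ^ n / fact n * ?u n t \<partial>lborel)"
      using a by (intro Bochner_Integration.integral_cong refl)
        (auto simp: norm_mult norm_divide norm_power indicator_def)
    also have "\<dots> = (a * cmod q) ^ n / fact n * (Gamma (x + real n) / a powr (x + real n))"
      using u[of n, THEN has_bochner_integral_integral_eq] by simp
    also have "\<dots> = Gamma x / a powr x * (((- x) gchoose n) * (- cmod q) ^ n)"
      using a by (simp add: G gbinomial_pochhammer powr_add powr_realpow power_mult_distrib power_minus' field_simps)
    finally show ?thesis .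
  qed
  have ig: "integral\<^sup>L lborel (?g n) = complex_of_real (Gamma x / a powr x) * (((- complex_of_real x) gchoose n) * q ^ n)" for n
  proof -
    have "integral\<^sup>L lborel (?g n) = ((- (of_real a * q)) ^ n / fact n) * complex_of_real (Gamma (x + real n) / a powr (x + real n))"
      by (simp only: integral_mult_right_zero integral_complex_of_real u[THEN has_bochner_integral_integral_eq])
    also have "\<dots> = complex_of_real (Gamma x / a powr x) * (((- complex_of_real x) gchoose n) * q ^ n)"
      using a by (simp add: G gbinomial_pochhammer powr_add powr_realpow power_mult_distrib power_minus' pochhammer_of_real field_simps)
    finally show ?thesis .
  qed
  have exp_summable: "summable (\<lambda>n. cmod (z ^ n / fact n))" for z
    using summable_norm_exp[of z] by (simp add: norm_divide norm_inverse norm_mult norm_power divide_inverse mult.commute)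
  have "(\<lambda>n. integral\<^sup>L lborel (?g n)) sums (\<integral>t. (\<Sum>n. ?g n t) \<partial>lborel)"
  proof (rule sums_integral)
    show "integrable lborel (?g n)" for n
      using u[of n, THEN integrable.intros] by (intro integrable_mult_right integrable_of_real)
    show "AE t in lborel. summable (\<lambda>n. norm (?g n t))"
      using AE_lborel_singleton[of 0]
    proof eventually_elim
      case (elim t)
      show ?case
        unfolding ug[OF elim] norm_mult
        by (intro summable_mult exp_summable)
    qed
    have "summable (\<lambda>n. ((- x) gchoose n) * (- cmod q) ^ n)"
      using gen_binomial_real[of "- cmod q" "- x"] q by (simp add: sums_iff)
    then show "summable (\<lambda>n. \<integral>t. norm (?g n t) \<partial>lborel)"
      unfolding ng by (rule summable_mult)
  qed
  moreover have "(\<lambda>n. integral\<^sup>L lborel (?g n)) sums (complex_of_real (Gamma x / a powr x) * (1 + q) powr (- complex_of_real x))"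
    unfolding ig by (intro sums_mult gen_binomial_complex q)
  ultimately have "(\<integral>t. (\<Sum>n. ?g n t) \<partial>lborel) = complex_of_real (Gamma x / a powr x) * (1 + q) powr (- complex_of_real x)"
    by (rule sums_unique2)
  also have "(\<integral>t. (\<Sum>n. ?g n t) \<partial>lborel) = integral\<^sup>L lborel ?f"
  proof (rule integral_cong_AE)
    show "AE t in lborel. (\<Sum>n. ?g n t) = ?f t"
      using AE_lborel_singleton[of 0]
    proof eventually_elim
      case (elim t)
      have "(\<lambda>n. (- (of_real a * q) * of_real t) ^ n / fact n) sums exp (- (of_real a * q) * of_real t)"
        using exp_converges[of "- (of_real a * q) * of_real t"] by (simp add: scaleR_conv_of_real divide_inverse mult_ac)
      then have "(\<lambda>n. ?g n t) sums (of_real (indicator {0..} t * (t powr (x - 1) * exp (- (a * t)))) * exp (- (of_real a * q) * of_real t))"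
        unfolding ug[OF elim] by (rule sums_mult)
      also have "of_real (indicator {0..} t * (t powr (x - 1) * exp (- (a * t)))) * exp (- (of_real a * q) * of_real t) = ?f t"
      proof -
        have "exp (- (s * complex_of_real t)) = complex_of_real (exp (- (a * t))) * exp (- (of_real a * q) * of_real t)"
          unfolding exp_of_real[symmetric] exp_add[symmetric] by (simp add: sq algebra_simps)
        then show ?thesis by (simp add: scaleR_conv_of_real)
      qed
      finally show ?case by (rule sums_unique[symmetric])
    qed
  qed measurable
  also have "complex_of_real (Gamma x / a powr x) * (1 + q) powr (- complex_of_real x) = complex_of_real (Gamma x) / s powr complex_of_real x"
  proof -
    \<comment> \<open>Since \<open>a\<close> is a positive real, the principal power is
      multiplicative here and no branch correction appears.\<close>
    have "s powr complex_of_real x = complex_of_real (a powr x) * (1 + q) powr complex_of_real x"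
      using a by (simp add: sq powr_times_real_left powr_of_real)
    then show ?thesis
      by (simp add: powr_minus divide_inverse)
  qed
  finally show "integral\<^sup>L lborel ?f = complex_of_real (Gamma x) / s powr complex_of_real x"
    by simp
qed

section \<open>A Tauberian lemma for Fejer averages\<close>

lemma fejer_shift_integral:
  fixes h :: "real \<Rightarrow> real"
  assumes "r > 0"
  shows "(\<integral>t. h t * (r * fejer (r * (x - t))) \<partial>lborel) = (\<integral>y. h (x - y / r) * fejer y \<partial>lborel)"
  by (subst lborel_integral_real_affine[where c = "- 1 / r" and t = x])
     (use assms in \<open>auto simp flip: integral_mult_right_zero intro!: Bochner_Integration.integral_cong\<close>)

lemma fejer_shift_integrable:
  assumes "r > 0"
  shows "integrable lborel (\<lambda>t. r * fejer (r * (x - t)))"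
  using lborel_integrable_real_affine[OF fejer_integrable, of "- r" "r * x"] assms
  by (simp add: algebra_simps)

lemma fejer_shift_mult_integrable:
  fixes f :: "real \<Rightarrow> real"
  assumes r: "r > 0" and f: "integrable lborel f"
  shows "integrable lborel (\<lambda>t. f t * (r * fejer (r * (x - t))))"
proof (rule Bochner_Integration.integrable_bound)
  show "integrable lborel (\<lambda>t. (5 * r) * f t)"
    using f by simp
  show "AE t in lborel. norm (f t * (r * fejer (r * (x - t)))) \<le> norm ((5 * r) * f t)"
  proof (rule AE_I2)
    fix t
    have "fejer y \<le> 5" for y
      using fejer_le[of y] le_imp_inverse_le[of 1 "1 + y\<^sup>2"] by simp
    then have "\<bar>f t\<bar> * (r * fejer (r * (x - t))) \<le> \<bar>f t\<bar> * (r * 5)"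
      using r by (intro mult_left_mono) auto
    then show "norm (f t * (r * fejer (r * (x - t)))) \<le> norm ((5 * r) * f t)"
      using r fejer_nonneg[of "r * (x - t)"] by (simp add: abs_mult mult_ac)
  qed
qed (use f in simp)

text \<open>The bandwidth stays fixed; concentration comes from the dilation by x. After
  substituting t = x - y/r the argument of \<open>w\<close> is (x - y/r)/x, which tends to 1 for
  each y, and boundedness of \<open>w\<close> allows dominated convergence.\<close>

lemma fejer_approx_identity:
  fixes w :: "real \<Rightarrow> real"
  assumes w [measurable]: "w \<in> borel_measurable borel"
    and B: "\<And>v. \<bar>w v\<bar> \<le> B" and cont: "isCont w 1" and r: "r > 0"
  shows "((\<lambda>x. \<integral>t. w (t / x) * (r * fejer (r * (x - t))) \<partial>lborel) \<longlongrightarrow> w 1 * fejer_mass) at_top"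
proof -
  have "((\<lambda>x. \<integral>y. w ((x - y / r) / x) * fejer y \<partial>lborel) \<longlongrightarrow> (\<integral>y. w 1 * fejer y \<partial>lborel)) at_top"
  proof (rule integral_dominated_convergence_at_top)
    show "integrable lborel (\<lambda>y. B * fejer y)"
      using fejer_integrable by simp
    show "\<forall>\<^sub>F x in at_top. AE y in lborel. norm (w ((x - y / r) / x) * fejer y) \<le> B * fejer y"
      using B fejer_nonneg by (intro always_eventually allI AE_I2) (auto simp: abs_mult intro!: mult_right_mono)
    show "AE y in lborel. ((\<lambda>x. w ((x - y / r) / x) * fejer y) \<longlongrightarrow> w 1 * fejer y) at_top"
    proof (intro AE_I2 tendsto_mult tendsto_const isCont_tendsto_compose[OF cont])
      fix y :: real
      show "((\<lambda>x. (x - y / r) / x) \<longlongrightarrow> 1) at_top" by real_asymp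
    qed
  qed simp_all
  then show ?thesis
    by (simp add: fejer_shift_integral[OF r] fejer_mass_def)
qed

lemma fejer_concentration:
  assumes "\<epsilon> > 0"
  obtains R where "R > 0" "(1 - \<epsilon>) * fejer_mass \<le> (\<integral>y. indicator {-R..R} y * fejer y \<partial>lborel)"
proof -
  have "((\<lambda>R. \<integral>y. indicator {-R..R} y * fejer y \<partial>lborel) \<longlongrightarrow> fejer_mass) at_top"
    unfolding fejer_mass_def
  proof (rule integral_dominated_convergence_at_top[OF _ _ fejer_integrable])
    show "\<forall>\<^sub>F R in at_top. AE y in lborel. norm (indicator {-R..R} y * fejer y) \<le> fejer y"
      using fejer_nonneg by (intro always_eventually allI AE_I2) (auto simp: indicator_def)
    show "AE y in lborel. ((\<lambda>R. indicator {-R..R} y * fejer y) \<longlongrightarrow> fejer y) at_top"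
    proof (intro AE_I2 tendsto_eventually)
      fix y :: real
      show "\<forall>\<^sub>F R in at_top. indicator {-R..R} y * fejer y = fejer y"
        using eventually_ge_at_top[of "\<bar>y\<bar>"] by eventually_elim (auto simp: indicator_def)
    qed
  qed simp_all
  moreover have "(1 - \<epsilon>) * fejer_mass < fejer_mass"
    using assms fejer_mass_pos by simp
  ultimately have "\<forall>\<^sub>F R in at_top. (1 - \<epsilon>) * fejer_mass < (\<integral>y. indicator {-R..R} y * fejer y \<partial>lborel)"
    by (rule order_tendstoD)
  with eventually_gt_at_top[of "0::real"]
  have "\<forall>\<^sub>F R in at_top. R > 0 \<and> (1 - \<epsilon>) * fejer_mass \<le> (\<integral>y. indicator {-R..R} y * fejer y \<partial>lborel)"
    by eventually_elim auto
  then show ?thesis using that by (auto dest: eventually_happens)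
qed

text \<open>The two one-sided bounds are not symmetric. For the upper one, positivity lets the
  average be restricted to a short window around x, where \<open>osc\<close> compares
  \<open>p t\<close> with \<open>p x\<close>. The lower one must also control the tail, and the
  growth estimate it needs is supplied by the upper bound.\<close>

lemma fejer_tauberian:
  fixes p W :: "real \<Rightarrow> real" and M a j B :: real
  assumes p [measurable]: "p \<in> borel_measurable borel"
    and p0: "\<And>t. 0 \<le> p t" and pneg: "\<And>t. t < 0 \<Longrightarrow> p t = 0"
    and osc: "\<And>t x. 0 \<le> t \<Longrightarrow> 0 \<le> x \<Longrightarrow> p t \<le> exp (M * \<bar>t - x\<bar>) * p x" and M: "0 \<le> M"
    and W [measurable]: "W \<in> borel_measurable borel"
    and W0: "\<And>v. 0 \<le> v \<Longrightarrow> 0 \<le> W v" and Wle: "\<And>v. 0 \<le> v \<Longrightarrow> W v \<le> v"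
    and W1: "0 < W 1" and Wcont: "isCont W 1"
    and WB: "\<And>v. 0 < v \<Longrightarrow> v powr (j - 1) * W v \<le> B"
    and j: "j > 0"
    and int: "\<And>x. x > 0 \<Longrightarrow> integrable lborel (\<lambda>t. p t * W (t / x))"
    and lim: "\<And>r. r > 0 \<Longrightarrow> ((\<lambda>x. x powr (1 - j) *
        (\<integral>t. p t * W (t / x) * (r * fejer (r * (x - t))) \<partial>lborel)) \<longlongrightarrow> a * W 1 * fejer_mass) at_top"
  shows "((\<lambda>x. p x * x powr (1 - j)) \<longlongrightarrow> a) at_top"
proof -
  define J where "J r x = (\<integral>t. p t * W (t / x) * (r * fejer (r * (x - t))) \<partial>lborel)" for r x
  have intJ: "integrable lborel (\<lambda>t. p t * W (t / x) * (r * fejer (r * (x - t))))" if "r > 0" "x > 0" for r x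
    using that by (intro fejer_shift_mult_integrable int)
  have localize: "\<exists>r \<delta>. r > 0 \<and> \<delta> > 0 \<and> 
      (1 - \<epsilon>) * fejer_mass \<le> (\<integral>y. indicator {-(r*\<delta>)..r*\<delta>} y * fejer y \<partial>lborel) \<and>
      exp (M * \<delta>) \<le> 1 + \<epsilon> \<and>
      (\<forall>\<^sub>F x in at_top. \<delta> < x \<and> (\<forall>t\<in>{x-\<delta>..x+\<delta>}. (1 - \<epsilon>) * W 1 \<le> W (t / x) \<and> W (t / x) \<le> (1 + \<epsilon>) * W 1))"
    if \<epsilon>: "0 < \<epsilon>" for \<epsilon>
  proof -
    \<comment> \<open>The window half-width is fixed first, small enough that \<open>osc\<close>
      costs only a factor 1 + \<open>\<epsilon>\<close>; the \<open>M + 1\<close> keeps the quotient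
      defined when \<open>M = 0\<close>. The bandwidth is chosen afterwards as
      \<open>R / \<delta>\<close>, so that the window holds all but a fraction
      \<open>\<epsilon>\<close> of the kernel mass.\<close>
    define \<delta> where "\<delta> = ln (1 + \<epsilon>) / (M + 1)"
    have \<delta>: "\<delta> > 0" using \<epsilon> M by (simp add: \<delta>_def)
    have "M * \<delta> \<le> ln (1 + \<epsilon>)"
      using \<epsilon> M by (simp add: \<delta>_def field_simps)
    then have e: "exp (M * \<delta>) \<le> 1 + \<epsilon>"
      using \<epsilon> by (metis add_pos_pos exp_le_cancel_iff exp_ln zero_less_one)
    obtain R where R: "R > 0" "(1 - \<epsilon>) * fejer_mass \<le> (\<integral>y. indicator {-R..R} y * fejer y \<partial>lborel)"
      using fejer_concentration[OF \<epsilon>] .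
    have "\<epsilon> * W 1 > 0" using \<epsilon> W1 by simp
    then obtain d where d0: "d > 0" and d1: "\<And>v. dist v 1 < d \<Longrightarrow> dist (W v) (W 1) < \<epsilon> * W 1"
      using Wcont[unfolded continuous_at_eps_delta] by meson
    have "\<forall>\<^sub>F x in at_top. \<delta> < x \<and> (\<forall>t\<in>{x-\<delta>..x+\<delta>}. (1 - \<epsilon>) * W 1 \<le> W (t / x) \<and> W (t / x) \<le> (1 + \<epsilon>) * W 1)"
      using eventually_gt_at_top[of \<delta>] eventually_gt_at_top[of "\<delta> / d"]
    proof eventually_elim
      case (elim x)
      have "(1 - \<epsilon>) * W 1 \<le> W (t / x) \<and> W (t / x) \<le> (1 + \<epsilon>) * W 1" if t: "t \<in> {x-\<delta>..x+\<delta>}" for t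
      proof -
        have x: "x > 0" using elim(1) \<delta> by linarith
        have "\<bar>t - x\<bar> \<le> \<delta>" using t by auto
        also have "\<delta> < d * x"
          using elim(2) d0 by (simp add: field_simps)
        finally have "\<bar>t - x\<bar> / x < d" using x by (simp add: field_simps)
        moreover have "t / x - 1 = (t - x) / x" using x by (simp add: field_simps)
        ultimately have "dist (t / x) 1 < d" using x by (simp add: dist_real_def)
        then have "\<bar>W (t / x) - W 1\<bar> < \<epsilon> * W 1"
          using d1 by (simp add: dist_real_def)
        then show ?thesis
          unfolding abs_less_iff by (simp add: algebra_simps)
      qed
      with elim(1) show ?case by blast
    qed
    then show ?thesis
      using R \<delta> e by (intro exI[of _ "R / \<delta>"] exI[of _ \<delta>]) auto
  qed
  have ind: "(\<integral>t. indicator {x-\<delta>..x+\<delta>} t * (r * fejer (r * (x - t))) \<partial>lborel)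
      = (\<integral>y. indicator {-(r*\<delta>)..r*\<delta>} y * fejer y \<partial>lborel)"
    and int_ind: "integrable lborel (\<lambda>t. indicator {x-\<delta>..x+\<delta>} t * (r * fejer (r * (x - t))))"
    if "r > 0" for r x \<delta> :: real
  proof -
    have "indicator {x-\<delta>..x+\<delta>} (x - y / r) = (indicator {-(r*\<delta>)..r*\<delta>} y :: real)" for y
      using that by (auto simp: indicator_def field_simps)
    then show "(\<integral>t. indicator {x-\<delta>..x+\<delta>} t * (r * fejer (r * (x - t))) \<partial>lborel)
      = (\<integral>y. indicator {-(r*\<delta>)..r*\<delta>} y * fejer y \<partial>lborel)"
      by (simp add: fejer_shift_integral[OF that])
    show "integrable lborel (\<lambda>t. indicator {x-\<delta>..x+\<delta>} t * (r * fejer (r * (x - t))))"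
      by (rule Bochner_Integration.integrable_bound[OF fejer_shift_integrable[OF that, of x]])
         (auto simp: indicator_def)
  qed
  have upper: "\<forall>\<^sub>F x in at_top. p x * x powr (1 - j) \<le> (a + \<epsilon>) * (1 + \<epsilon>) / (1 - \<epsilon>)\<^sup>2"
    if \<epsilon>: "0 < \<epsilon>" "\<epsilon> < 1" for \<epsilon>
  proof -
    from localize[OF \<epsilon>(1)] obtain r \<delta> where r: "r > 0" and \<delta>: "\<delta> > 0"
      and c: "(1 - \<epsilon>) * fejer_mass \<le> (\<integral>y. indicator {-(r*\<delta>)..r*\<delta>} y * fejer y \<partial>lborel)"
      and e: "exp (M * \<delta>) \<le> 1 + \<epsilon>"
      and ev: "\<forall>\<^sub>F x in at_top. \<delta> < x \<and> (\<forall>t\<in>{x-\<delta>..x+\<delta>}. (1 - \<epsilon>) * W 1 \<le> W (t / x) \<and> W (t / x) \<le> (1 + \<epsilon>) * W 1)"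
      by blast
    have "\<forall>\<^sub>F x in at_top. x powr (1 - j) * J r x < (a + \<epsilon>) * W 1 * fejer_mass"
      using lim[OF r] unfolding J_def
      by (rule order_tendstoD) (use \<epsilon> W1 fejer_mass_pos in \<open>simp add: algebra_simps\<close>)
    with ev eventually_gt_at_top[of "0::real"] show ?thesis
    proof eventually_elim
      case (elim x)
      \<comment> \<open>\<open>?c\<close> is a lower bound for \<open>p t * W (t / x)\<close>
        throughout the window; outside it the nonnegative integrand is dropped.\<close>
      let ?c = "p x / (1 + \<epsilon>) * ((1 - \<epsilon>) * W 1)"
      have "?c * ((1 - \<epsilon>) * fejer_mass) \<le> ?c * (\<integral>t. indicator {x-\<delta>..x+\<delta>} t * (r * fejer (r * (x - t))) \<partial>lborel)"
        unfolding ind[OF r] using c \<epsilon> p0[of x] W1 by (intro mult_left_mono) auto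
      also have "\<dots> = (\<integral>t. ?c * (indicator {x-\<delta>..x+\<delta>} t * (r * fejer (r * (x - t)))) \<partial>lborel)"
        by simp
      also have "\<dots> \<le> J r x"
        unfolding J_def
      proof (rule integral_mono[OF _ intJ])
        show "integrable lborel (\<lambda>t. ?c * (indicator {x-\<delta>..x+\<delta>} t * (r * fejer (r * (x - t)))))"
          using int_ind[OF r] by simp
        fix t :: real
        have k: "0 \<le> r * fejer (r * (x - t))"
          using r fejer_nonneg by simp
        have nn: "0 \<le> p t * W (t / x)"
          using p0[of t] W0[of "t / x"] pneg[of t] elim by (cases "t < 0") auto
        have "?c \<le> p t * W (t / x)" if t: "t \<in> {x-\<delta>..x+\<delta>}"
        proof -
          have "p x \<le> exp (M * \<bar>x - t\<bar>) * p t"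
            using osc[of x t] t elim by auto
          also have "\<dots> \<le> (1 + \<epsilon>) * p t"
          proof (intro mult_right_mono p0 order_trans[OF _ e])
            show "exp (M * \<bar>x - t\<bar>) \<le> exp (M * \<delta>)"
              using t M by (auto intro!: mult_left_mono)
          qed
          finally have "p x / (1 + \<epsilon>) \<le> p t"
            using \<epsilon> by (simp add: field_simps)
          then show ?thesis
            using elim t \<epsilon> W1 p0 by (intro mult_mono) auto
        qed
        then show "?c * (indicator {x-\<delta>..x+\<delta>} t * (r * fejer (r * (x - t)))) \<le> p t * W (t / x) * (r * fejer (r * (x - t)))"
          using mult_right_mono[OF _ k, of ?c "p t * W (t / x)"] mult_nonneg_nonneg[OF nn k]
          by (cases "t \<in> {x-\<delta>..x+\<delta>}") auto
      qed (use r elim in auto)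
      finally have "x powr (1 - j) * (?c * ((1 - \<epsilon>) * fejer_mass)) \<le> x powr (1 - j) * J r x"
        by (intro mult_left_mono) auto
      also have "\<dots> \<le> (a + \<epsilon>) * W 1 * fejer_mass"
        using elim by simp
      finally have "(p x * x powr (1 - j) * (1 - \<epsilon>)\<^sup>2 / (1 + \<epsilon>)) * (W 1 * fejer_mass) \<le> (a + \<epsilon>) * (W 1 * fejer_mass)"
        by (simp add: power2_eq_square mult_ac)
      then have "p x * x powr (1 - j) * (1 - \<epsilon>)\<^sup>2 / (1 + \<epsilon>) \<le> a + \<epsilon>"
        using W1 fejer_mass_pos by (subst (asm) mult_le_cancel_right_pos) auto
      then show ?case
        using \<epsilon> by (simp add: field_simps)
    qed
  qed
  \<comment> \<open>The upper bound at \<open>\<epsilon>\<close> = 1/2 already gives growth of order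
    t^(j-1) for \<open>p\<close> beyond some \<open>X0\<close>. The absolute value makes
    \<open>C\<close> nonnegative whatever the sign of \<open>a\<close>.\<close>
  define C where "C = \<bar>(a + 1/2) * (1 + 1/2) / (1 - 1/2)\<^sup>2\<bar>"
  have C: "C \<ge> 0" by (simp add: C_def)
  have "\<forall>\<^sub>F x in at_top. p x * x powr (1 - j) \<le> (a + 1/2) * (1 + 1/2) / (1 - 1/2)\<^sup>2"
    by (rule upper) auto
  then obtain X where X: "\<And>x. x \<ge> X \<Longrightarrow> p x * x powr (1 - j) \<le> (a + 1/2) * (1 + 1/2) / (1 - 1/2)\<^sup>2"
    unfolding eventually_at_top_linorder by blast
  define X0 where "X0 = max 1 X"
  have X0: "X0 \<ge> 1" by (simp add: X0_def)
  have CX: "p x * x powr (1 - j) \<le> C" if "x \<ge> X0" for x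
    using order_trans[OF X abs_ge_self] that by (simp add: X0_def C_def)
  define D where "D = exp (M * X0) * p 0 * X0"
  have D: "D \<ge> 0" using X0 p0 by (simp add: D_def)
  have B: "B \<ge> 0" using WB[of 1] W1 by simp
  have pW: "p t * W (t / x) \<le> C * B * x powr (j - 1) + D / x" if x: "x > 0" for t x
  proof -
    consider "t < 0" | "0 \<le> t" "t < X0" | "t \<ge> X0" by linarith
    then show ?thesis
    proof cases
      case 1
      then show ?thesis using pneg x C B D by simp
    next
      case 2
      have "p t \<le> exp (M * \<bar>t - 0\<bar>) * p 0"
        using osc[of t 0] 2 by auto
      also have "\<dots> \<le> exp (M * X0) * p 0"
        using 2 M p0 by (intro mult_right_mono) (auto intro: mult_left_mono)
      finally have "p t * W (t / x) \<le> (exp (M * X0) * p 0) * (X0 / x)"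
        using 2 x p0 order_trans[OF Wle[of "t / x"], of "X0 / x"] W0
        by (intro mult_mono) (auto simp: divide_right_mono)
      also have "\<dots> = D / x" by (simp add: D_def)
      also have "\<dots> \<le> C * B * x powr (j - 1) + D / x"
        using C B by simp
      finally show ?thesis .
    next
      case 3
      have "p t = p t * t powr (1 - j) * t powr (j - 1)"
        using 3 X0 by (simp add: powr_add[symmetric] mult.assoc)
      also have "\<dots> \<le> C * t powr (j - 1)"
        using CX[OF 3] by (intro mult_right_mono) auto
      finally have "p t * W (t / x) \<le> C * t powr (j - 1) * W (t / x)"
        using 3 X0 x W0 by (intro mult_right_mono) auto
      also have "\<dots> = C * x powr (j - 1) * ((t / x) powr (j - 1) * W (t / x))"
        using x 3 X0 by (simp add: powr_divide)
      also have "\<dots> \<le> C * x powr (j - 1) * B"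
        using C WB[of "t / x"] x 3 X0 by (intro mult_left_mono) auto
      also have "\<dots> \<le> C * B * x powr (j - 1) + D / x"
        using D x by (simp add: mult_ac)
      finally show ?thesis .
    qed
  qed
  have lower: "\<forall>\<^sub>F x in at_top. ((a - \<epsilon>) - (C * B + 1) * \<epsilon> / W 1) / (1 + \<epsilon>)\<^sup>2 \<le> p x * x powr (1 - j)"
    if \<epsilon>: "0 < \<epsilon>" "\<epsilon> < 1" for \<epsilon>
  proof -
    from localize[OF \<epsilon>(1)] obtain r \<delta> where r: "r > 0" and \<delta>: "\<delta> > 0"
      and c: "(1 - \<epsilon>) * fejer_mass \<le> (\<integral>y. indicator {-(r*\<delta>)..r*\<delta>} y * fejer y \<partial>lborel)"
      and e: "exp (M * \<delta>) \<le> 1 + \<epsilon>"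
      and ev: "\<forall>\<^sub>F x in at_top. \<delta> < x \<and> (\<forall>t\<in>{x-\<delta>..x+\<delta>}. (1 - \<epsilon>) * W 1 \<le> W (t / x) \<and> W (t / x) \<le> (1 + \<epsilon>) * W 1)"
      by blast
    have "\<forall>\<^sub>F x in at_top. (a - \<epsilon>) * W 1 * fejer_mass < x powr (1 - j) * J r x"
      using lim[OF r] unfolding J_def
      by (rule order_tendstoD) (use \<epsilon> W1 fejer_mass_pos in \<open>simp add: algebra_simps\<close>)
    \<comment> \<open>After normalisation by x^(1-j) the contribution \<open>D / x\<close> of the
      initial stretch becomes D x^(-j), which vanishes because \<open>j\<close> is positive.\<close>
    moreover have "((\<lambda>x. x powr (- j) * D) \<longlongrightarrow> 0) at_top"
      using tendsto_mult_left_zero[OF tendsto_neg_powr[OF _ filterlim_ident]] j by auto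
    then have "\<forall>\<^sub>F x in at_top. x powr (- j) * D < 1"
      by (rule order_tendstoD) simp
    ultimately show ?thesis
      using ev eventually_gt_at_top[of "0::real"]
    proof eventually_elim
      case (elim x)
      let ?k = "\<lambda>t. r * fejer (r * (x - t))"
      let ?I = "\<lambda>t. indicator {x-\<delta>..x+\<delta>} t :: real"
      let ?c = "(1 + \<epsilon>) * p x * ((1 + \<epsilon>) * W 1)"
      let ?d = "C * B * x powr (j - 1) + D / x"
      have mass: "(\<integral>t. ?k t \<partial>lborel) = fejer_mass"
        using fejer_shift_integral[OF r, of "\<lambda>_. 1" x] by (simp add: fejer_mass_def)
      have d0: "?d \<ge> 0" using C B D elim by simp
      have lin: "(\<integral>t. c * f t + d * (f t - g t) \<partial>lborel) = c * (\<integral>t. f t \<partial>lborel) + d * ((\<integral>t. f t \<partial>lborel) - (\<integral>t. g t \<partial>lborel))"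
        if "integrable lborel f" "integrable lborel g" for f g :: "real \<Rightarrow> real" and c d
        using that by simp
      \<comment> \<open>The window bound \<open>?c\<close> is charged on the whole line, so that its
        total is exactly the kernel mass; the crude bound \<open>?d\<close> from \<open>pW\<close>
        is charged only outside the window, where at most a fraction \<open>\<epsilon>\<close> of
        the mass lies.\<close>
      have "J r x \<le> (\<integral>t. ?c * ?k t + ?d * (?k t - ?I t * ?k t) \<partial>lborel)"
        unfolding J_def
      proof (rule integral_mono[OF intJ])
        show "integrable lborel (\<lambda>t. ?c * ?k t + ?d * (?k t - ?I t * ?k t))"
          by (rule Bochner_Integration.integrable_add[OF integrable_mult_right[OF fejer_shift_integrable[OF r]]
            integrable_mult_right[OF Bochner_Integration.integrable_diff[OF fejer_shift_integrable[OF r] int_ind[OF r]]]])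
        fix t :: real
        have k: "0 \<le> ?k t"
          using r fejer_nonneg by simp
        show "p t * W (t / x) * ?k t \<le> ?c * ?k t + ?d * (?k t - ?I t * ?k t)"
        proof (cases "t \<in> {x-\<delta>..x+\<delta>}")
          case True
          have "p t \<le> exp (M * \<bar>t - x\<bar>) * p x"
            using osc[of t x] True elim by auto
          also have "\<dots> \<le> (1 + \<epsilon>) * p x"
          proof (intro mult_right_mono p0 order_trans[OF _ e])
            show "exp (M * \<bar>t - x\<bar>) \<le> exp (M * \<delta>)"
              using True M by (auto intro!: mult_left_mono)
          qed
          finally have "p t * W (t / x) \<le> ?c"
            using elim True \<epsilon> W1 p0 W0[of "t / x"] by (intro mult_mono) auto
          then show ?thesis
            using True mult_right_mono[OF _ k, of "p t * W (t / x)" ?c] by simp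
        next
          case False
          have "0 \<le> ?c" using \<epsilon> p0[of x] W1 by simp
          then show ?thesis
            using False mult_right_mono[OF pW[of x t] k] elim mult_nonneg_nonneg[OF _ k, of ?c] by simp
        qed
      qed (use r elim in auto)
      also have "\<dots> = ?c * fejer_mass + ?d * (fejer_mass - (\<integral>y. indicator {-(r*\<delta>)..r*\<delta>} y * fejer y \<partial>lborel))"
        unfolding lin[OF fejer_shift_integrable[OF r] int_ind[OF r]] mass ind[OF r] ..
      also have "\<dots> \<le> ?c * fejer_mass + ?d * (\<epsilon> * fejer_mass)"
        using c d0 by (intro add_left_mono mult_left_mono) (auto simp: algebra_simps)
      finally have "x powr (1 - j) * J r x \<le> x powr (1 - j) * (?c * fejer_mass + ?d * (\<epsilon> * fejer_mass))"
        by (intro mult_left_mono) auto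
      also have "\<dots> = (1 + \<epsilon>)\<^sup>2 * (p x * x powr (1 - j)) * W 1 * fejer_mass
          + (x powr (1 - j) * ?d) * \<epsilon> * fejer_mass"
        by (simp add: algebra_simps power2_eq_square)
      also have "x powr (1 - j) * ?d = C * B + x powr (- j) * D"
      proof -
        have "x powr (1 - j) * x powr (j - 1) = 1"
          using elim by (simp add: powr_add[symmetric])
        moreover have "x powr (1 - j) / x = x powr (- j)"
          using elim by (simp add: powr_diff powr_minus field_simps)
        moreover have "x powr (1 - j) * ?d = C * B * (x powr (1 - j) * x powr (j - 1)) + (x powr (1 - j) / x) * D"
          by (simp add: algebra_simps)
        ultimately show ?thesis
          by simp
      qed
      also have "(C * B + x powr (- j) * D) * \<epsilon> * fejer_mass \<le> (C * B + 1) * \<epsilon> * fejer_mass"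
        using elim \<epsilon> fejer_mass_pos by (intro mult_right_mono) auto
      finally have "((a - \<epsilon>) * W 1) * fejer_mass \<le> ((1 + \<epsilon>)\<^sup>2 * (p x * x powr (1 - j)) * W 1 + (C * B + 1) * \<epsilon>) * fejer_mass"
        using elim by (simp add: algebra_simps)
      then have "(a - \<epsilon>) * W 1 \<le> (1 + \<epsilon>)\<^sup>2 * (p x * x powr (1 - j)) * W 1 + (C * B + 1) * \<epsilon>"
        using fejer_mass_pos by (subst (asm) mult_le_cancel_right_pos)
      then have "(a - \<epsilon>) - (C * B + 1) * \<epsilon> / W 1 \<le> (p x * x powr (1 - j)) * (1 + \<epsilon>)\<^sup>2"
        using W1 by (simp add: field_simps)
      then show ?case
        using \<epsilon> by (simp add: pos_divide_le_eq)
    qed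
  qed
  show ?thesis
  proof (rule order_tendstoI)
    fix l assume l: "l < a"
    \<comment> \<open>\<open>C\<close> and \<open>B\<close> were fixed before
      \<open>\<epsilon>\<close>, so the lower bound really tends to \<open>a\<close> as
      \<open>\<epsilon>\<close> decreases to 0.\<close>
    have "((\<lambda>\<epsilon>. ((a - \<epsilon>) - (C * B + 1) * \<epsilon> / W 1) / (1 + \<epsilon>)\<^sup>2) \<longlongrightarrow> ((a - 0) - (C * B + 1) * 0 / W 1) / (1 + 0)\<^sup>2) (at_right 0)"
      using W1 by (intro tendsto_intros) auto
    then have "\<forall>\<^sub>F \<epsilon> in at_right 0. l < ((a - \<epsilon>) - (C * B + 1) * \<epsilon> / W 1) / (1 + \<epsilon>)\<^sup>2"
      by (rule order_tendstoD) (use l in simp)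
    moreover have "\<forall>\<^sub>F \<epsilon> in at_right 0. 0 < \<epsilon> \<and> \<epsilon> < (1::real)"
      by (auto simp: eventually_at_right_field intro: exI[of _ 1])
    ultimately have "\<forall>\<^sub>F \<epsilon> in at_right 0. 0 < \<epsilon> \<and> \<epsilon> < 1 \<and> l < ((a - \<epsilon>) - (C * B + 1) * \<epsilon> / W 1) / (1 + \<epsilon>)\<^sup>2"
      by eventually_elim auto
    then obtain \<epsilon> where "0 < \<epsilon>" "\<epsilon> < 1" "l < ((a - \<epsilon>) - (C * B + 1) * \<epsilon> / W 1) / (1 + \<epsilon>)\<^sup>2"
      by (auto dest: eventually_happens)
    with lower[of \<epsilon>] show "\<forall>\<^sub>F x in at_top. l < p x * x powr (1 - j)"
      by (auto elim: eventually_mono)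
  next
    fix u assume u: "a < u"
    have "((\<lambda>\<epsilon>. (a + \<epsilon>) * (1 + \<epsilon>) / (1 - \<epsilon>)\<^sup>2) \<longlongrightarrow> (a + 0) * (1 + 0) / (1 - 0)\<^sup>2) (at_right 0)"
      by (intro tendsto_intros) auto
    then have "\<forall>\<^sub>F \<epsilon> in at_right 0. (a + \<epsilon>) * (1 + \<epsilon>) / (1 - \<epsilon>)\<^sup>2 < u"
      by (rule order_tendstoD) (use u in simp)
    moreover have "\<forall>\<^sub>F \<epsilon> in at_right 0. 0 < \<epsilon> \<and> \<epsilon> < (1::real)"
      by (auto simp: eventually_at_right_field intro: exI[of _ 1])
    ultimately have "\<forall>\<^sub>F \<epsilon> in at_right 0. 0 < \<epsilon> \<and> \<epsilon> < 1 \<and> (a + \<epsilon>) * (1 + \<epsilon>) / (1 - \<epsilon>)\<^sup>2 < u"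
      by eventually_elim auto
    then obtain \<epsilon> where "0 < \<epsilon>" "\<epsilon> < 1" "(a + \<epsilon>) * (1 + \<epsilon>) / (1 - \<epsilon>)\<^sup>2 < u"
      by (auto dest: eventually_happens)
    with upper[of \<epsilon>] show "\<forall>\<^sub>F x in at_top. p x * x powr (1 - j) < u"
      by (auto elim: eventually_mono)
  qed
qed

section \<open>Boundary behaviour of the transform\<close>

lemma shifted_abs_integral:
  fixes \<Phi> f :: "real \<Rightarrow> real"
  assumes \<Phi>: "\<And>x. x > 0 \<Longrightarrow> (\<Phi> has_real_derivative f x) (at x)"
    and f: "continuous_on {0<..} f" and "\<sigma> > 0" "r > 0"
  shows "has_bochner_integral lborel (\<lambda>t. indicator {-r..r} t * f (\<sigma> + \<bar>t\<bar>)) (2 * (\<Phi> (\<sigma> + r) - \<Phi> \<sigma>))"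
proof -
  have cont: "continuous_on {-r..r} (\<lambda>t. f (\<sigma> + \<bar>t\<bar>))"
    by (intro continuous_on_compose2[OF f] continuous_intros) (use assms(3) in auto)
  have int: "integrable lborel (\<lambda>t. indicator {-r..r} t * f (\<sigma> + \<bar>t\<bar>))"
    using borel_integrable_atLeastAtMost'[OF cont] by (simp add: set_integrable_def)
  have "((\<lambda>t. f (\<sigma> + \<bar>t\<bar>)) has_integral (\<integral>t. indicator {-r..r} t * f (\<sigma> + \<bar>t\<bar>) \<partial>lborel)) {-r..r}"
    using has_integral_set_lebesgue[OF absolutely_integrable_continuous_real[OF cont]] int
    unfolding set_lebesgue_integral_def by (simp add: integral_completion)
  moreover have "((\<lambda>t. f (\<sigma> + \<bar>t\<bar>)) has_integral ((- \<Phi> (\<sigma> - 0)) - (- \<Phi> (\<sigma> - (-r)))) + (\<Phi> (\<sigma> + r) - \<Phi> (\<sigma> + 0))) {-r..r}"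
  proof (rule has_integral_combine[of _ 0])
    have "((\<lambda>t. f (\<sigma> - t)) has_integral ((- \<Phi> (\<sigma> - 0)) - (- \<Phi> (\<sigma> - (-r))))) {-r..0}"
    proof (rule fundamental_theorem_of_calculus)
      fix t assume t: "t \<in> {-r..0}"
      have "((\<lambda>t. \<Phi> (\<sigma> - t)) has_real_derivative f (\<sigma> - t) * (- 1)) (at t within {-r..0})"
        by (rule DERIV_chain2[OF \<Phi>]) (use t assms(3) in \<open>auto intro!: derivative_eq_intros\<close>)
      from DERIV_minus[OF this]
      show "((\<lambda>t. - \<Phi> (\<sigma> - t)) has_vector_derivative f (\<sigma> - t)) (at t within {-r..0})"
        by (simp add: has_real_derivative_iff_has_vector_derivative)
    qed (use assms(4) in simp)
    then show "((\<lambda>t. f (\<sigma> + \<bar>t\<bar>)) has_integral ((- \<Phi> (\<sigma> - 0)) - (- \<Phi> (\<sigma> - (-r))))) {-r..0}"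
      by (rule has_integral_eq[rotated]) auto
    have "((\<lambda>t. f (\<sigma> + t)) has_integral (\<Phi> (\<sigma> + r) - \<Phi> (\<sigma> + 0))) {0..r}"
    proof (rule fundamental_theorem_of_calculus)
      fix t assume t: "t \<in> {0..r}"
      have "((\<lambda>t. \<Phi> (\<sigma> + t)) has_real_derivative f (\<sigma> + t) * 1) (at t within {0..r})"
        by (rule DERIV_chain2[OF \<Phi>]) (use t assms(3) in \<open>auto intro!: derivative_eq_intros\<close>)
      then show "((\<lambda>t. \<Phi> (\<sigma> + t)) has_vector_derivative f (\<sigma> + t)) (at t within {0..r})"
        by (simp add: has_real_derivative_iff_has_vector_derivative)
    qed (use assms(4) in simp)
    then show "((\<lambda>t. f (\<sigma> + \<bar>t\<bar>)) has_integral (\<Phi> (\<sigma> + r) - \<Phi> (\<sigma> + 0))) {0..r}"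
      by (rule has_integral_eq[rotated]) auto
  qed (use assms(4) in auto)
  ultimately have "(\<integral>t. indicator {-r..r} t * f (\<sigma> + \<bar>t\<bar>) \<partial>lborel)
      = ((- \<Phi> (\<sigma> - 0)) - (- \<Phi> (\<sigma> - (-r)))) + (\<Phi> (\<sigma> + r) - \<Phi> (\<sigma> + 0))"
    by (rule has_integral_unique)
  then show ?thesis using int by (simp add: has_bochner_integral_iff)
qed

lemma shifted_powr_integral:
  fixes p \<sigma> r :: real
  assumes "p \<noteq> 1" "\<sigma> > 0" "r > 0"
  shows "has_bochner_integral lborel (\<lambda>t. indicator {-r..r} t * (\<sigma> + \<bar>t\<bar>) powr (-p))
    (2 * ((\<sigma> + r) powr (1 - p) / (1 - p) - \<sigma> powr (1 - p) / (1 - p)))"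
proof (rule shifted_abs_integral)
  show "((\<lambda>x. x powr (1 - p) / (1 - p)) has_real_derivative x powr (-p)) (at x)" if "x > 0" for x :: real
    using has_real_derivative_powr[OF that, of "1 - p", THEN DERIV_cdivide, of "1 - p"] assms(1) by simp
  show "continuous_on {0<..} (\<lambda>x::real. x powr (-p))"
    by (intro continuous_on_powr continuous_on_id continuous_on_const) auto
qed (use assms in auto)

lemma shifted_inverse_integral:
  fixes \<sigma> r :: real
  assumes "\<sigma> > 0" "r > 0"
  shows "has_bochner_integral lborel (\<lambda>t. indicator {-r..r} t * (\<sigma> + \<bar>t\<bar>) powr (-1)) (2 * (ln (\<sigma> + r) - ln \<sigma>))"
proof (rule shifted_abs_integral)
  show "(ln has_real_derivative x powr (-1)) (at x)" if "x > 0" for x :: real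
    using DERIV_ln[OF that] that by (simp add: powr_minus)
  show "continuous_on {0<..} (\<lambda>x::real. x powr (-1))"
    by (intro continuous_on_powr continuous_on_id continuous_on_const) auto
qed (use assms in auto)

lemma shifted_powr_integrable:
  fixes p \<sigma> r :: real
  assumes "\<sigma> > 0" "r > 0"
  shows "integrable lborel (\<lambda>t. indicator {-r..r} t * (\<sigma> + \<bar>t\<bar>) powr (-p))"
  using shifted_powr_integral[OF _ assms] shifted_inverse_integral[OF assms]
  by (cases "p = 1") (auto intro: integrable.intros)

text \<open>As \<open>\<sigma>\<close> decreases to 0 the integral stays bounded for j < 1, grows
  like the logarithm for j = 1 and like \<open>\<sigma>\<close>^(1-j) for j > 1. These are the three
  branches of the weight; the absolute value is there because the logarithm is negative.\<close>

lemma g_weight_dominates: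
  assumes j: "j > 0" and r: "r > 0"
  obtains C where "C \<ge> 0" "\<forall>\<^sub>F \<sigma> in at_right 0.
    \<sigma> powr (j - 1) * (\<integral>t. indicator {-r..r} t * (\<sigma> + \<bar>t\<bar>) powr (-j) \<partial>lborel) \<le> C * \<bar>g_weight j \<sigma>\<bar>"
proof -
  \<comment> \<open>Staying below 1/2 keeps \<open>- ln \<sigma>\<close> at least
    \<open>ln 2\<close>, so that for j = 1 the constant \<open>ln (1 + r)\<close> can be absorbed
    into a multiple of the logarithm.\<close>
  have ev: "\<forall>\<^sub>F \<sigma> in at_right 0. 0 < \<sigma> \<and> \<sigma> < (1/2::real)"
    using eventually_at_right_real[of 0 "1/2::real"] by (auto elim: eventually_mono)
  consider "j < 1" | "j = 1" | "j > 1" by linarith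
  then show ?thesis
  proof cases
    case 1
    show ?thesis
    proof (rule that)
      show "0 \<le> 2 * (1 + r) powr (1 - j) / (1 - j)" using 1 by simp
      show "\<forall>\<^sub>F \<sigma> in at_right 0. \<sigma> powr (j - 1) * (\<integral>t. indicator {-r..r} t * (\<sigma> + \<bar>t\<bar>) powr (-j) \<partial>lborel)
          \<le> 2 * (1 + r) powr (1 - j) / (1 - j) * \<bar>g_weight j \<sigma>\<bar>"
        using ev
      proof eventually_elim
        case (elim \<sigma>)
        have "(\<integral>t. indicator {-r..r} t * (\<sigma> + \<bar>t\<bar>) powr (-j) \<partial>lborel)
            = 2 * ((\<sigma> + r) powr (1 - j) / (1 - j) - \<sigma> powr (1 - j) / (1 - j))"
          using shifted_powr_integral[of j \<sigma> r] 1 elim r by (auto dest: has_bochner_integral_integral_eq)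
        also have "\<dots> \<le> 2 * ((1 + r) powr (1 - j) / (1 - j) - 0)"
          using 1 elim r by (intro mult_left_mono diff_mono divide_right_mono powr_mono2) auto
        finally have "\<sigma> powr (j - 1) * (\<integral>t. indicator {-r..r} t * (\<sigma> + \<bar>t\<bar>) powr (-j) \<partial>lborel)
            \<le> \<sigma> powr (j - 1) * (2 * ((1 + r) powr (1 - j) / (1 - j) - 0))"
          by (intro mult_left_mono) auto
        then show ?case
          using 1 by (simp add: g_weight_def mult_ac)
      qed
    qed
  next
    case 2
    show ?thesis
    proof (rule that)
      show "0 \<le> 2 * (ln (1 + r) / ln 2 + 1)" using r by simp
      show "\<forall>\<^sub>F \<sigma> in at_right 0. \<sigma> powr (j - 1) * (\<integral>t. indicator {-r..r} t * (\<sigma> + \<bar>t\<bar>) powr (-j) \<partial>lborel)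
          \<le> 2 * (ln (1 + r) / ln 2 + 1) * \<bar>g_weight j \<sigma>\<bar>"
        using ev
      proof eventually_elim
        case (elim \<sigma>)
        have l: "ln 2 \<le> - ln \<sigma>"
          using elim ln_mono[of \<sigma> "1/2"] by (simp add: ln_div)
        have "(\<integral>t. indicator {-r..r} t * (\<sigma> + \<bar>t\<bar>) powr (-j) \<partial>lborel) = 2 * (ln (\<sigma> + r) - ln \<sigma>)"
          using shifted_inverse_integral[of \<sigma> r] 2 elim r by (auto dest: has_bochner_integral_integral_eq)
        also have "\<dots> \<le> 2 * (ln (1 + r) + (- ln \<sigma>))"
          using elim r by (simp add: ln_mono)
        also have "ln (1 + r) = ln (1 + r) / ln 2 * ln 2" by simp
        also have "2 * (ln (1 + r) / ln 2 * ln 2 + (- ln \<sigma>)) \<le> 2 * (ln (1 + r) / ln 2 * (- ln \<sigma>) + (- ln \<sigma>))"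
          using l r by (intro mult_left_mono add_right_mono) auto
        also have "\<dots> = 2 * (ln (1 + r) / ln 2 + 1) * (- ln \<sigma>)"
          by (simp add: algebra_simps)
        also have "- ln \<sigma> = \<bar>g_weight j \<sigma>\<bar>"
          using 2 elim by (simp add: g_weight_def)
        finally show ?case using 2 elim by simp
      qed
    qed
  next
    case 3
    show ?thesis
    proof (rule that)
      show "0 \<le> 2 / (j - 1)" using 3 by simp
      show "\<forall>\<^sub>F \<sigma> in at_right 0. \<sigma> powr (j - 1) * (\<integral>t. indicator {-r..r} t * (\<sigma> + \<bar>t\<bar>) powr (-j) \<partial>lborel)
          \<le> 2 / (j - 1) * \<bar>g_weight j \<sigma>\<bar>"
        using ev
      proof eventually_elim
        case (elim \<sigma>)
        have "(\<integral>t. indicator {-r..r} t * (\<sigma> + \<bar>t\<bar>) powr (-j) \<partial>lborel)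
            = 2 * ((\<sigma> + r) powr (1 - j) / (1 - j) - \<sigma> powr (1 - j) / (1 - j))"
          using shifted_powr_integral[of j \<sigma> r] 3 elim r by (auto dest: has_bochner_integral_integral_eq)
        also have "\<dots> = 2 / (j - 1) * (\<sigma> powr (1 - j) - (\<sigma> + r) powr (1 - j))"
        proof -
          have "X / (1 - j) = - (X / (j - 1))" for X
            using minus_divide_right[of X "j - 1"] by simp
          then show ?thesis by (simp add: right_diff_distrib)
        qed
        also have "\<dots> \<le> 2 / (j - 1) * \<sigma> powr (1 - j)"
          using 3 by (intro mult_left_mono) auto
        finally have "\<sigma> powr (j - 1) * (\<integral>t. indicator {-r..r} t * (\<sigma> + \<bar>t\<bar>) powr (-j) \<partial>lborel)
            \<le> \<sigma> powr (j - 1) * (2 / (j - 1) * \<sigma> powr (1 - j))"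
          by (intro mult_left_mono) auto
        also have "\<dots> = 2 / (j - 1) * (\<sigma> powr (j - 1) * \<sigma> powr (1 - j))"
          by simp
        also have "\<sigma> powr (j - 1) * \<sigma> powr (1 - j) = 1"
          using elim by (simp add: powr_add[symmetric])
        finally show ?case using 3 by (simp add: g_weight_def)
      qed
    qed
  qed
qed

text \<open>Both \<open>\<sigma>\<close> and the imaginary part are bounded by the modulus, so their
  sum is at most twice the modulus. This replaces the modulus by an expression with an explicit
  antiderivative.\<close>

lemma cmod_powr_neg_le:
  assumes "\<sigma> > 0" "\<sigma> \<le> Re z" "p \<ge> 0"
  shows "cmod z powr (-p) \<le> 2 powr p * (\<sigma> + \<bar>Im z\<bar>) powr (-p)"
proof -
  have "\<sigma> + \<bar>Im z\<bar> \<le> cmod z + cmod z"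
    by (intro add_mono abs_Im_le_cmod order_trans[OF assms(2) complex_Re_le_cmod])
  then have "(\<sigma> + \<bar>Im z\<bar>) / 2 \<le> cmod z"
    by simp
  then have "cmod z powr (-p) \<le> ((\<sigma> + \<bar>Im z\<bar>) / 2) powr (-p)"
    using assms by (intro powr_mono2') auto
  also have "\<dots> = 2 powr p * (\<sigma> + \<bar>Im z\<bar>) powr (-p)"
    using assms by (simp add: powr_divide powr_minus field_simps)
  finally show ?thesis .
qed

text \<open>A mean value estimate along the horizontal ray from \<open>Complex \<sigma> t\<close> to
  the right: the ray is convex, avoids the branch cut, and the derivative is controlled on it by the
  preceding bound with exponent \<open>j + 1\<close>.\<close>

lemma powr_neg_difference_le:
  assumes "\<sigma> > 0" "j > 0"
  shows "cmod (Complex \<sigma> t powr (- complex_of_real j) - Complex (2 * \<sigma>) t powr (- complex_of_real j))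
    \<le> j * 2 powr (j + 1) * \<sigma> * (\<sigma> + \<bar>t\<bar>) powr (- (j + 1))"
proof -
  \<comment> \<open>The ray is written as an intersection of half-planes, which makes convexity
    immediate.\<close>
  let ?S = "{z. \<sigma> \<le> Re z} \<inter> ({z. Im z \<le> t} \<inter> {z. t \<le> Im z})"
  have "cmod (Complex \<sigma> t powr (- complex_of_real j) - Complex (2 * \<sigma>) t powr (- complex_of_real j))
    \<le> (j * (2 powr (j + 1) * (\<sigma> + \<bar>t\<bar>) powr (- (j + 1)))) * cmod (Complex \<sigma> t - Complex (2 * \<sigma>) t)"
  proof (rule field_differentiable_bound[where S = ?S and f = "\<lambda>z. z powr (- complex_of_real j)"
        and f' = "\<lambda>z. - complex_of_real j * z powr (- complex_of_real j - 1)"])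
    show "convex ?S"
      by (intro convex_Int convex_halfspace_Re_ge convex_halfspace_Im_le convex_halfspace_Im_ge)
    fix z assume z: "z \<in> ?S"
    then have "z \<notin> \<real>\<^sub>\<le>\<^sub>0" using assms by (auto simp: complex_nonpos_Reals_iff)
    then show "((\<lambda>z. z powr (- complex_of_real j)) has_field_derivative
        - complex_of_real j * z powr (- complex_of_real j - 1)) (at z within ?S)"
      by (rule has_field_derivative_at_within[OF has_field_derivative_powr])
    have e: "- complex_of_real j - 1 = complex_of_real (- (j + 1))" by simp
    have n: "cmod (- complex_of_real j) = j" using assms by simp
    have "cmod (- complex_of_real j * z powr (- complex_of_real j - 1)) = j * cmod z powr (- (j + 1))"
      by (simp only: e n norm_mult norm_powr_real_powr'[OF Reals_of_real] Re_complex_of_real)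
    also have "\<dots> \<le> j * (2 powr (j + 1) * (\<sigma> + \<bar>t\<bar>) powr (- (j + 1)))"
      using cmod_powr_neg_le[of \<sigma> z "j + 1"] z assms by (intro mult_left_mono) auto
    finally show "cmod (- complex_of_real j * z powr (- complex_of_real j - 1)) \<le> \<dots>" .
  qed (use assms in auto)
  also have "cmod (Complex \<sigma> t - Complex (2 * \<sigma>) t) = \<sigma>"
    using assms by (simp add: cmod_def)
  finally show ?thesis by (simp add: mult_ac)
qed

text \<open>Here \<open>q\<close> abstracts the frequency-side integrand: the tent and the
  oscillating factor have modulus at most 1, so only absolute values are estimated and no
  cancellation from oscillation is used. The three pieces are handled by \<open>lim\<close>, by
  continuity of \<open>G\<close> at 0, and by the Lipschitz bound on \<open>h\<close>.\<close>

lemma boundary_difference_limit: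
  fixes G h M :: "complex \<Rightarrow> complex" and q :: "real \<Rightarrow> real \<Rightarrow> complex"
  assumes j: "j > 0" and d: "d > 0" and r: "r > 0" and L: "L \<ge> 0"
    and G: "continuous_on {s. 0 \<le> Re s \<and> Re s \<le> d} G"
    and h: "\<And>s s'. s \<in> cbox (Complex 0 (-r)) (Complex d r) \<Longrightarrow> s' \<in> cbox (Complex 0 (-r)) (Complex d r) \<Longrightarrow>
        cmod (h s - h s') \<le> L * cmod (s - s')"
    and lim: "((\<lambda>\<sigma>. g_weight j \<sigma> * (SUP t\<in>{-r..r}. cmod (G (Complex (2 * \<sigma>) t) - G (Complex \<sigma> t)))) \<longlongrightarrow> 0) (at_right 0)"
  defines "M \<equiv> \<lambda>s. (G s - G 0) / s powr complex_of_real j + h s"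
  assumes q: "\<And>\<sigma> t. 0 < \<sigma> \<Longrightarrow> 2 * \<sigma> \<le> d \<Longrightarrow>
      cmod (q \<sigma> t) \<le> indicator {-r..r} t * cmod (M (Complex \<sigma> t) - M (Complex (2 * \<sigma>) t))"
  shows "((\<lambda>\<sigma>. \<sigma> powr (j - 1) * cmod (\<integral>t. q \<sigma> t \<partial>lborel)) \<longlongrightarrow> 0) (at_right 0)"
proof -
  let ?K = "cbox (Complex 0 (-r)) (Complex d r)"
  define S where "S \<sigma> = (SUP t\<in>{-r..r}. cmod (G (Complex (2 * \<sigma>) t) - G (Complex \<sigma> t)))" for \<sigma>
  define Q where "Q p \<sigma> = (\<integral>t. indicator {-r..r} t * (\<sigma> + \<bar>t\<bar>) powr (-p) \<partial>lborel)" for p \<sigma>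
  have "continuous_on ?K G"
    by (rule continuous_on_subset[OF G]) (auto simp: in_cbox_complex_iff)
  then have "bounded (G ` ?K)"
    by (intro compact_imp_bounded compact_continuous_image compact_cbox)
  then obtain b where b: "b > 0" "\<And>s. s \<in> ?K \<Longrightarrow> cmod (G s) \<le> b"
    unfolding bounded_pos by auto
  have K: "Complex \<sigma> t \<in> ?K \<and> Complex (2 * \<sigma>) t \<in> ?K" if "0 < \<sigma>" "2 * \<sigma> \<le> d" "t \<in> {-r..r}" for \<sigma> t
    using that by (auto simp: in_cbox_complex_iff)
  have K0: "0 \<in> ?K"
    using d r by (simp add: in_cbox_complex_iff)
  have S: "cmod (G (Complex (2 * \<sigma>) t) - G (Complex \<sigma> t)) \<le> S \<sigma>" if "0 < \<sigma>" "2 * \<sigma> \<le> d" "t \<in> {-r..r}" for \<sigma> t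
    unfolding S_def
  proof (rule cSUP_upper[OF that(3)])
    have "cmod (G (Complex (2 * \<sigma>) t) - G (Complex \<sigma> t)) \<le> b + b" if "t \<in> {-r..r}" for t
      using K[OF \<open>0 < \<sigma>\<close> \<open>2 * \<sigma> \<le> d\<close> that] b by (intro norm_triangle_le_diff add_mono) auto
    then show "bdd_above ((\<lambda>t. cmod (G (Complex (2 * \<sigma>) t) - G (Complex \<sigma> t))) ` {-r..r})"
      by (intro bdd_aboveI2[of _ _ "b + b"])
  qed
  have S0: "0 \<le> S \<sigma>" if "0 < \<sigma>" "2 * \<sigma> \<le> d" for \<sigma>
    using order_trans[OF norm_ge_zero S[OF that, of 0]] r by simp
  obtain C where C: "C \<ge> 0" "\<forall>\<^sub>F \<sigma> in at_right 0. \<sigma> powr (j - 1) * Q j \<sigma> \<le> C * \<bar>g_weight j \<sigma>\<bar>"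
    unfolding Q_def using g_weight_dominates[OF j r] .
  \<comment> \<open>The middle kernel has mass of exactly the critical order
    \<open>\<sigma>\<close>^(1-j), so the required gain must come from the smallness of
    \<open>G\<close> minus \<open>G 0\<close> where the kernel concentrates.\<close>
  have Q1: "\<sigma> * Q (j + 1) \<sigma> \<le> 2 / j * \<sigma> powr (1 - j)" if "0 < \<sigma>" for \<sigma>
  proof -
    have "Q (j + 1) \<sigma> = 2 * ((\<sigma> + r) powr (1 - (j + 1)) / (1 - (j + 1)) - \<sigma> powr (1 - (j + 1)) / (1 - (j + 1)))"
      unfolding Q_def using shifted_powr_integral[of "j + 1" \<sigma> r] j that r
      by (intro has_bochner_integral_integral_eq) auto
    also have "\<dots> = 2 / j * (\<sigma> powr (-j) - (\<sigma> + r) powr (-j))"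
      using j by (simp add: field_simps)
    also have "\<dots> \<le> 2 / j * \<sigma> powr (-j)"
      using j by (intro mult_left_mono) auto
    finally have "\<sigma> * Q (j + 1) \<sigma> \<le> \<sigma> * (2 / j * \<sigma> powr (-j))"
      using that by (intro mult_left_mono) auto
    also have "\<dots> = 2 / j * \<sigma> powr (1 - j)"
      using that by (simp add: powr_diff powr_minus field_simps)
    finally show ?thesis .
  qed
  \<comment> \<open>\<open>D\<close> may depend on \<open>\<epsilon>\<close> but not on
    \<open>\<sigma>\<close>, so its term dies with \<open>\<sigma>\<close>^j once
    \<open>\<epsilon>\<close> has been fixed.\<close>
  have bound: "\<exists>D. \<forall>\<sigma>. 0 < \<sigma> \<longrightarrow> 2 * \<sigma> \<le> d \<longrightarrow> \<sigma> powr (j - 1) * cmod (\<integral>t. q \<sigma> t \<partial>lborel)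
      \<le> 2 powr j * (\<sigma> powr (j - 1) * Q j \<sigma>) * S \<sigma> + 2 powr (j + 2) * \<epsilon> + D * \<sigma> powr j"
    if \<epsilon>: "\<epsilon> > 0" for \<epsilon>
  proof -
    have "continuous (at 0 within {s. 0 \<le> Re s \<and> Re s \<le> d}) G"
      using G d by (simp add: continuous_on_eq_continuous_within)
    then obtain \<eta> where \<eta>: "\<eta> > 0" "\<And>s. 0 \<le> Re s \<Longrightarrow> Re s \<le> d \<Longrightarrow> cmod s < \<eta> \<Longrightarrow> cmod (G s - G 0) < \<epsilon>"
      using \<epsilon> unfolding continuous_within_eps_delta dist_norm by force
    \<comment> \<open>\<open>E\<close> covers points at distance at least \<open>\<eta>\<close> from
      0: there \<open>\<sigma> + \<bar>t\<bar>\<close> is at least \<open>\<eta> / 2\<close>,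
      because the modulus of \<open>Complex (2 * \<sigma>) t\<close> is at most twice it, while the
      values of \<open>G\<close> differ by at most \<open>2 * b\<close>.\<close>
    define E where "E = 2 * b * (\<eta> / 2) powr (- (j + 1))"
    have E: "E \<ge> 0" using b by (simp add: E_def)
    show ?thesis
    proof (intro exI allI impI)
      fix \<sigma> assume \<sigma>: "0 < \<sigma>" "2 * \<sigma> \<le> d"
      let ?b = "\<lambda>t. 2 powr j * S \<sigma> * (\<sigma> + \<bar>t\<bar>) powr (-j)
          + j * 2 powr (j + 1) * \<sigma> * (\<epsilon> * (\<sigma> + \<bar>t\<bar>) powr (-(j + 1)) + E) + L * \<sigma>"
      have pw: "cmod (M (Complex \<sigma> t) - M (Complex (2 * \<sigma>) t)) \<le> ?b t" if t: "t \<in> {-r..r}" for t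
      proof -
        let ?s = "Complex \<sigma> t" and ?s' = "Complex (2 * \<sigma>) t"
        let ?P = "\<lambda>s. s powr (- complex_of_real j)"
        note KK = K[OF \<sigma> t]
        have M: "M s = (G s - G 0) * ?P s + h s" for s
          by (simp add: M_def powr_minus divide_inverse)
        have "M ?s - M ?s' = - ((G ?s' - G ?s) * ?P ?s) + (G ?s' - G 0) * (?P ?s - ?P ?s') + (h ?s - h ?s')"
          unfolding M by (simp add: algebra_simps)
        also have "cmod \<dots> \<le> cmod (G ?s' - G ?s) * cmod (?P ?s) + cmod (G ?s' - G 0) * cmod (?P ?s - ?P ?s') + cmod (h ?s - h ?s')"
          by (intro norm_triangle_le add_mono) (auto simp: norm_mult)
        also have "cmod (G ?s' - G ?s) * cmod (?P ?s) \<le> S \<sigma> * (2 powr j * (\<sigma> + \<bar>t\<bar>) powr (-j))"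
        proof (intro mult_mono S \<sigma> t S0)
          have "cmod (?P ?s) = cmod ?s powr (-j)"
            using norm_powr_real_powr'[of "complex_of_real (-j)" ?s] by simp
          also have "\<dots> \<le> 2 powr j * (\<sigma> + \<bar>t\<bar>) powr (-j)"
            using cmod_powr_neg_le[of \<sigma> ?s j] \<sigma> j by simp
          finally show "cmod (?P ?s) \<le> 2 powr j * (\<sigma> + \<bar>t\<bar>) powr (-j)" .
        qed simp
        also have "cmod (G ?s' - G 0) * cmod (?P ?s - ?P ?s') \<le> cmod (G ?s' - G 0) * (j * 2 powr (j + 1) * \<sigma> * (\<sigma> + \<bar>t\<bar>) powr (- (j + 1)))"
          by (intro mult_left_mono powr_neg_difference_le \<sigma> j) simp
        also have "\<dots> = j * 2 powr (j + 1) * \<sigma> * (cmod (G ?s' - G 0) * (\<sigma> + \<bar>t\<bar>) powr (- (j + 1)))"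
          by (simp add: mult_ac)
        also have "cmod (G ?s' - G 0) * (\<sigma> + \<bar>t\<bar>) powr (- (j + 1)) \<le> \<epsilon> * (\<sigma> + \<bar>t\<bar>) powr (-(j + 1)) + E"
        proof (cases "cmod ?s' < \<eta>")
          case True
          then have "cmod (G ?s' - G 0) \<le> \<epsilon>"
            using \<eta>(2)[of ?s'] \<sigma> by simp
          then have "cmod (G ?s' - G 0) * (\<sigma> + \<bar>t\<bar>) powr (- (j + 1)) \<le> \<epsilon> * (\<sigma> + \<bar>t\<bar>) powr (- (j + 1))"
            by (intro mult_right_mono) auto
          then show ?thesis using E by simp
        next
          case False
          have "\<eta> \<le> cmod ?s'" using False by simp
          also have "\<dots> \<le> \<bar>2 * \<sigma>\<bar> + \<bar>t\<bar>"
            using cmod_le[of ?s'] by simp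
          finally have "\<eta> / 2 \<le> \<sigma> + \<bar>t\<bar>" using \<sigma> by simp
          then have "(\<sigma> + \<bar>t\<bar>) powr (- (j + 1)) \<le> (\<eta> / 2) powr (- (j + 1))"
            using \<eta> j by (intro powr_mono2') auto
          moreover have "cmod (G ?s' - G 0) \<le> 2 * b"
            using norm_triangle_le_diff[of "G ?s'" "G 0" "2 * b"] b(2)[of ?s'] b(2)[OF K0] KK by simp
          ultimately have "cmod (G ?s' - G 0) * (\<sigma> + \<bar>t\<bar>) powr (- (j + 1)) \<le> E"
            unfolding E_def using b by (intro mult_mono) auto
          then show ?thesis using \<epsilon> by (intro add_increasing) auto
        qed
        also have "cmod (h ?s - h ?s') \<le> L * \<sigma>"
        proof -
          have "cmod (?s - ?s') = \<sigma>" using \<sigma> by (simp add: cmod_def)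
          with h[of ?s ?s'] KK show ?thesis by simp
        qed
        finally show ?thesis
          using \<sigma> j by (simp add: mult_ac)
      qed
      let ?I = "indicator {-r..r} :: real \<Rightarrow> real"
      let ?B = "\<lambda>t. 2 powr j * S \<sigma> * (?I t * (\<sigma> + \<bar>t\<bar>) powr (-j))
          + (j * 2 powr (j + 1) * \<sigma> * \<epsilon> * (?I t * (\<sigma> + \<bar>t\<bar>) powr (-(j + 1)))
          + (j * 2 powr (j + 1) * \<sigma> * E + L * \<sigma>) * ?I t)"
      have i1: "has_bochner_integral lborel (\<lambda>t. ?I t * (\<sigma> + \<bar>t\<bar>) powr (-p)) (Q p \<sigma>)" for p
        using shifted_powr_integrable[OF \<sigma>(1) r] by (simp add: has_bochner_integral_iff Q_def)
      have i2: "has_bochner_integral lborel ?I (2 * r)"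
        using r by (simp add: has_bochner_integral_iff)
      have iB: "has_bochner_integral lborel ?B (2 powr j * S \<sigma> * Q j \<sigma>
         + (j * 2 powr (j + 1) * \<sigma> * \<epsilon> * Q (j + 1) \<sigma> + (j * 2 powr (j + 1) * \<sigma> * E + L * \<sigma>) * (2 * r)))"
        by (intro has_bochner_integral_add has_bochner_integral_mult_right i1 i2)
      have "cmod (\<integral>t. q \<sigma> t \<partial>lborel) \<le> (\<integral>t. cmod (q \<sigma> t) \<partial>lborel)"
        by (rule integral_norm_bound)
      also have "\<dots> \<le> (\<integral>t. ?B t \<partial>lborel)"
      \<comment> \<open>Integrability of \<open>q \<sigma>\<close> is not among the hypotheses. The
        integral of a non-integrable function is 0 by convention, so nonnegativity of the integrable
        majorant settles that case.\<close>
      proof (rule integral_mono')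
        show "integrable lborel ?B" using iB by (rule integrable.intros)
        fix t :: real
        have "cmod (q \<sigma> t) \<le> ?I t * cmod (M (Complex \<sigma> t) - M (Complex (2 * \<sigma>) t))"
          by (rule q[OF \<sigma>])
        also have "\<dots> \<le> ?B t"
        proof (cases "t \<in> {-r..r}")
          case True
          then show ?thesis using pw[OF True] by (simp add: algebra_simps)
        qed simp
        finally show "cmod (q \<sigma> t) \<le> ?B t" .
        then show "0 \<le> ?B t" using norm_ge_zero order_trans by blast
      qed
      also have "\<dots> = 2 powr j * S \<sigma> * Q j \<sigma>
         + (j * 2 powr (j + 1) * \<epsilon> * (\<sigma> * Q (j + 1) \<sigma>) + (j * 2 powr (j + 1) * E + L) * (2 * r) * \<sigma>)"
        using has_bochner_integral_integral_eq[OF iB] by (simp add: algebra_simps)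
      also have "\<dots> \<le> 2 powr j * S \<sigma> * Q j \<sigma>
         + (j * 2 powr (j + 1) * \<epsilon> * (2 / j * \<sigma> powr (1 - j)) + (j * 2 powr (j + 1) * E + L) * (2 * r) * \<sigma>)"
        using Q1[OF \<sigma>(1)] j \<epsilon> by (intro add_left_mono add_right_mono mult_left_mono) auto
      finally have "\<sigma> powr (j - 1) * cmod (\<integral>t. q \<sigma> t \<partial>lborel) \<le> \<sigma> powr (j - 1) * \<dots>"
        by (intro mult_left_mono) auto
      also have "\<dots> = 2 powr j * (\<sigma> powr (j - 1) * Q j \<sigma>) * S \<sigma>
          + 2 * 2 powr (j + 1) * \<epsilon> * (\<sigma> powr (j - 1) * \<sigma> powr (1 - j))
          + (j * 2 powr (j + 1) * E + L) * (2 * r) * (\<sigma> powr (j - 1) * \<sigma>)"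
        using j by (simp add: distrib_left mult_ac)
      also have "\<sigma> powr (j - 1) * \<sigma> powr (1 - j) = 1"
        using \<sigma> by (simp add: powr_add[symmetric])
      also have "\<sigma> powr (j - 1) * \<sigma> = \<sigma> powr j"
        using \<sigma> by (simp add: powr_diff)
      also have "2 * 2 powr (j + 1) = 2 powr (j + 2)"
        by (simp add: powr_add)
      finally show "\<sigma> powr (j - 1) * cmod (\<integral>t. q \<sigma> t \<partial>lborel)
        \<le> 2 powr j * (\<sigma> powr (j - 1) * Q j \<sigma>) * S \<sigma> + 2 powr (j + 2) * \<epsilon>
          + ((j * 2 powr (j + 1) * E + L) * (2 * r)) * \<sigma> powr j"
        by simp
    qed
  qed
  show ?thesis
  proof (rule tendstoI)
    fix e :: real assume e: "e > 0"
    \<comment> \<open>This makes the continuity term exactly \<open>e / 2\<close>; the other two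
      terms together are eventually below the remaining half.\<close>
    define \<epsilon> where "\<epsilon> = e / 2 / 2 powr (j + 2)"
    have \<epsilon>: "\<epsilon> > 0" "2 powr (j + 2) * \<epsilon> = e / 2" using e by (auto simp: \<epsilon>_def)
    from bound[OF \<epsilon>(1)] obtain D where D: "\<And>\<sigma>. 0 < \<sigma> \<Longrightarrow> 2 * \<sigma> \<le> d \<Longrightarrow> \<sigma> powr (j - 1) * cmod (\<integral>t. q \<sigma> t \<partial>lborel)
      \<le> 2 powr j * (\<sigma> powr (j - 1) * Q j \<sigma>) * S \<sigma> + 2 powr (j + 2) * \<epsilon> + D * \<sigma> powr j"
      by blast
    have "((\<lambda>\<sigma>. 2 powr j * C * \<bar>g_weight j \<sigma> * S \<sigma>\<bar> + D * \<sigma> powr j) \<longlongrightarrow> 2 powr j * C * \<bar>0\<bar> + D * 0) (at_right 0)"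
      unfolding S_def
    proof (intro tendsto_intros lim)
      show "((\<lambda>\<sigma>. \<sigma> powr j) \<longlongrightarrow> 0) (at_right (0::real))"
        using j by real_asymp
    qed
    then have "\<forall>\<^sub>F \<sigma> in at_right 0. 2 powr j * C * \<bar>g_weight j \<sigma> * S \<sigma>\<bar> + D * \<sigma> powr j < e / 2"
      by (rule order_tendstoD) (use e in simp)
    moreover have "\<forall>\<^sub>F \<sigma> in at_right 0. \<sigma> \<in> {0<..<d / 2}"
      using d by (intro eventually_at_right_real) simp
    ultimately show "\<forall>\<^sub>F \<sigma> in at_right 0. dist (\<sigma> powr (j - 1) * cmod (\<integral>t. q \<sigma> t \<partial>lborel)) 0 < e"
      using C(2)
    proof eventually_elim
      case (elim \<sigma>)
      then have \<sigma>: "0 < \<sigma>" "2 * \<sigma> \<le> d" by auto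
      have "\<sigma> powr (j - 1) * cmod (\<integral>t. q \<sigma> t \<partial>lborel)
          \<le> 2 powr j * (\<sigma> powr (j - 1) * Q j \<sigma>) * S \<sigma> + 2 powr (j + 2) * \<epsilon> + D * \<sigma> powr j"
        by (rule D[OF \<sigma>])
      also have "2 powr j * (\<sigma> powr (j - 1) * Q j \<sigma>) * S \<sigma> \<le> 2 powr j * (C * \<bar>g_weight j \<sigma>\<bar>) * S \<sigma>"
        using elim S0[OF \<sigma>] by (intro mult_right_mono mult_left_mono) auto
      also have "\<dots> = 2 powr j * C * \<bar>g_weight j \<sigma> * S \<sigma>\<bar>"
        using S0[OF \<sigma>] by (simp add: abs_mult)
      finally show ?case
        using elim \<epsilon>(2) by (simp add: dist_real_def)
    qed
  qed
qed

section \<open>Half-line integrals and the exponential weight\<close>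

text \<open>For a nonnegative integrand the truncations over [0, n] increase, so monotone
  convergence turns convergence of the improper integral into Lebesgue integrability. Applied at
  real exponents, it gives absolute convergence on whole vertical lines.\<close>

lemma halfline_integral_nonneg_integrable:
  fixes g :: "real \<Rightarrow> real"
  assumes m: "(\<lambda>t. indicator {0..} t * g t) \<in> borel_measurable borel"
    and g: "\<And>t. 0 \<le> t \<Longrightarrow> 0 \<le> g t"
    and L: "has_halfline_integral (\<lambda>t. complex_of_real (g t)) L"
  shows "integrable lborel (\<lambda>t. indicator {0..} t * g t)"
proof (rule integral_monotone_convergence_nonneg(1))
  let ?f = "\<lambda>n t. indicator {0..real n} t * g t"
  have hk: "g integrable_on {0..real n}" "integral {0..real n} g = Re (integral {0..real n} (\<lambda>t. complex_of_real (g t)))" for n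
  proof -
    have *: "(\<lambda>t. complex_of_real (g t)) integrable_on {0..real n}"
      using L by (simp add: has_halfline_integral_def)
    show "g integrable_on {0..real n}"
      using integrable_linear[OF * bounded_linear_Re] by (simp add: o_def)
    show "integral {0..real n} g = Re (integral {0..real n} (\<lambda>t. complex_of_real (g t)))"
      using integral_linear[OF * bounded_linear_Re] by (simp add: o_def)
  qed
  have mf: "?f n \<in> borel_measurable borel" for n
  proof -
    have "?f n = (\<lambda>t. indicator {..real n} t * (indicator {0..} t * g t))"
      by (auto simp: indicator_def)
    then show ?thesis using m by simp
  qed
  have ai: "g absolutely_integrable_on {0..real n}" for n
    using hk(1) g by (intro nonnegative_absolutely_integrable_1) auto
  show "integrable lborel (?f n)" for n
    using ai[of n] mf[of n] by (simp add: set_integrable_def integrable_completion)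
  have "integral\<^sup>L lborel (?f n) = integral {0..real n} g" for n
    using set_lebesgue_integral_eq_integral(2)[OF ai[of n]] mf[of n]
    by (simp add: set_lebesgue_integral_def integral_completion)
  then have "(\<lambda>n. integral\<^sup>L lborel (?f n)) = (\<lambda>n. Re (integral {0..real n} (\<lambda>t. complex_of_real (g t))))"
    by (simp add: hk(2))
  moreover have "(\<lambda>n. integral {0..real n} (\<lambda>t. complex_of_real (g t))) \<longlonglongrightarrow> L"
    using L filterlim_compose[OF _ filterlim_real_sequentially] by (auto simp: has_halfline_integral_def)
  ultimately show "(\<lambda>n. integral\<^sup>L lborel (?f n)) \<longlonglongrightarrow> Re L"
    by (simp add: tendsto_Re)
  show "AE t in lborel. mono (\<lambda>n. ?f n t)"
    using g by (intro AE_I2 monoI) (auto simp: indicator_def)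
  show "AE t in lborel. (\<lambda>n. ?f n t) \<longlonglongrightarrow> indicator {0..} t * g t"
  proof (intro AE_I2 tendsto_eventually)
    fix t :: real
    show "\<forall>\<^sub>F n in sequentially. ?f n t = indicator {0..} t * g t"
      using eventually_ge_at_top[of "nat \<lceil>t\<rceil>"]
      by eventually_elim (auto simp: indicator_def nat_le_iff ceiling_le_iff)
  qed
qed (use g m in \<open>auto simp: indicator_def\<close>)

lemma halfline_integral_eq_lborel:
  fixes u :: "real \<Rightarrow> complex"
  assumes u: "integrable lborel (\<lambda>t. indicator {0..} t *\<^sub>R u t)" and L: "has_halfline_integral u L"
  shows "(\<integral>t. indicator {0..} t *\<^sub>R u t \<partial>lborel) = L"
proof (rule tendsto_unique[of at_top])
  let ?f = "\<lambda>t. indicator {0..} t *\<^sub>R u t"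
  show "((\<lambda>y. \<integral>t. indicator {..y} t *\<^sub>R ?f t \<partial>lborel) \<longlongrightarrow> integral\<^sup>L lborel ?f) at_top"
    by (rule tendsto_integral_at_top[OF _ u]) simp
  have "((\<lambda>R. integral {0..R} u) \<longlongrightarrow> L) at_top"
    using L by (simp add: has_halfline_integral_def)
  moreover have "integral {0..y} u = (\<integral>t. indicator {..y} t *\<^sub>R ?f t \<partial>lborel)" for y
  proof -
    have "set_integrable lborel {0..} u"
      using u by (simp add: set_integrable_def)
    then have "set_integrable lborel {0..y} u"
      by (rule set_integrable_subset) auto
    from set_borel_integral_eq_integral(2)[OF this]
    have "integral {0..y} u = (\<integral>t. indicator {0..y} t *\<^sub>R u t \<partial>lborel)"
      by (simp add: set_lebesgue_integral_def)
    also have "\<dots> = (\<integral>t. indicator {..y} t *\<^sub>R ?f t \<partial>lborel)"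
      by (intro Bochner_Integration.integral_cong) (auto simp: indicator_def)
    finally show ?thesis .
  qed
  ultimately show "((\<lambda>y. \<integral>t. indicator {..y} t *\<^sub>R ?f t \<partial>lborel) \<longlongrightarrow> L) at_top"
    by simp
qed simp

text \<open>The derivative is bounded by compactness, and convexity provides the segment for the
  mean value estimate. It is meant for \<open>H\<close>, which is holomorphic across the boundary
  line.\<close>

lemma holomorphic_lipschitz_on_compact_convex:
  assumes "f holomorphic_on U" "open U" "compact K" "convex K" "K \<subseteq> U"
  obtains L where "L \<ge> 0" "\<And>x y. x \<in> K \<Longrightarrow> y \<in> K \<Longrightarrow> cmod (f x - f y) \<le> L * cmod (x - y)"
proof -
  have "continuous_on K (deriv f)"
    using holomorphic_on_imp_continuous_on[OF holomorphic_deriv[OF assms(1,2)]] assms(5)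
    by (rule continuous_on_subset)
  then have "bounded (deriv f ` K)"
    using assms(3) by (intro compact_imp_bounded compact_continuous_image)
  then obtain L where L: "L > 0" "\<And>x. x \<in> K \<Longrightarrow> cmod (deriv f x) \<le> L"
    unfolding bounded_pos by auto
  have d: "(f has_field_derivative deriv f x) (at x within K)" if "x \<in> K" for x
    using holomorphic_derivI[OF assms(1,2)] that assms(5) by (auto intro: has_field_derivative_at_within)
  show ?thesis
    using field_differentiable_bound[OF assms(4) d L(2)] L(1) that[of L] by auto
qed

text \<open>At v = t/x the two exponentials are the dampings with rates 1/x and 2/x, so the weighted
  transform is a difference of the kind hypothesis (2) controls. The zero at v = 0 suppresses
  bounded t, where no asymptotic information on the function is available.\<close>

definition exp_gap :: "real \<Rightarrow> real" where
  "exp_gap v = exp (- v) - exp (- (2 * v))"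

lemma exp_gap_measurable [measurable]: "exp_gap \<in> borel_measurable borel"
  unfolding exp_gap_def by measurable

lemma isCont_exp_gap: "isCont exp_gap v"
  unfolding exp_gap_def by (intro continuous_intros)

lemma exp_gap_nonneg: "0 \<le> v \<Longrightarrow> 0 \<le> exp_gap v"
  by (simp add: exp_gap_def)

lemma exp_gap_pos: "0 < exp_gap 1"
  by (simp add: exp_gap_def)

lemma exp_gap_le:
  assumes "0 \<le> v"
  shows "exp_gap v \<le> v"
proof -
  have "exp_gap v = exp (- v) * (1 - exp (- v))"
    by (simp add: exp_gap_def algebra_simps exp_add[symmetric])
  also have "\<dots> \<le> 1 * v"
    using assms exp_ge_add_one_self[of "- v"] by (intro mult_mono) auto
  finally show ?thesis by simp
qed

text \<open>Up to 1 the linear zero of the gap leaves v^j, at most 1 even for j < 1. Beyond 1 the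
  function is below v^j e^(-v), whose maximum, at v = j, is the second summand of the bound.\<close>

lemma powr_exp_gap_bounded:
  assumes j: "j > 0"
  obtains B where "\<And>v. 0 < v \<Longrightarrow> v powr (j - 1) * exp_gap v \<le> B"
proof (rule that)
  fix v :: real assume v: "0 < v"
  show "v powr (j - 1) * exp_gap v \<le> 1 + exp (j * ln j - j)"
  proof (cases "v \<le> 1")
    case True
    have "v powr (j - 1) * exp_gap v \<le> v powr (j - 1) * v"
      using v exp_gap_le by (intro mult_left_mono) auto
    also have "\<dots> = v powr j" using v by (simp add: powr_diff)
    also have "\<dots> \<le> 1" using True v j by (intro powr_le1) auto
    finally show ?thesis by (simp add: add_increasing2)
  next
    case False
    have "v powr (j - 1) * exp_gap v \<le> v powr j * exp (- v)"
      using False v j by (intro mult_mono powr_mono exp_gap_nonneg) (auto simp: exp_gap_def)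
    also have "\<dots> = exp (j * ln v - v)"
      using v by (simp add: powr_def exp_diff exp_minus divide_inverse)
    also have "j * ln v - v \<le> j * ln j - j"
    proof -
      have "ln v - ln j \<le> v / j - 1"
        using ln_le_minus_one[of "v / j"] v j by (simp add: ln_div)
      then have "j * (ln v - ln j) \<le> j * (v / j - 1)"
        using j by (intro mult_left_mono) auto
      then show ?thesis using j by (simp add: algebra_simps)
    qed
    finally show ?thesis by simp
  qed
qed

text \<open>By homogeneity x^(1-j) t^(j-1) = (t/x)^(j-1), so the normalised average is that of a
  fixed bounded function of t/x.\<close>

lemma powr_kernel_limit:
  assumes j: "j > 0" and r: "r > 0"
  shows "((\<lambda>x. x powr (1 - j) * (\<integral>t. indicator {0..} t * t powr (j - 1) * exp_gap (t / x) * (r * fejer (r * (x - t))) \<partial>lborel))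
    \<longlongrightarrow> exp_gap 1 * fejer_mass) at_top"
proof -
  \<comment> \<open>Clamping at 0 extends the function by zero to negative arguments, since both
    \<open>0 powr y\<close> and \<open>exp_gap 0\<close> are 0.\<close>
  define w where "w v = max 0 v powr (j - 1) * exp_gap (max 0 v)" for v
  obtain B where B: "\<And>v. 0 < v \<Longrightarrow> v powr (j - 1) * exp_gap v \<le> B"
    using powr_exp_gap_bounded[OF j] by blast
  have B0: "0 \<le> B"
    using B[of 1] exp_gap_pos by simp
  have "((\<lambda>x. \<integral>t. w (t / x) * (r * fejer (r * (x - t))) \<partial>lborel) \<longlongrightarrow> w 1 * fejer_mass) at_top"
  proof (rule fejer_approx_identity[OF _ _ _ r])
    show "w \<in> borel_measurable borel"
      unfolding w_def by measurable
    show "\<bar>w v\<bar> \<le> B" for v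
      using B[of v] B0 exp_gap_nonneg[of v] by (cases "v > 0") (auto simp: w_def max_def)
    show "isCont w 1"
      unfolding w_def exp_gap_def by (intro continuous_intros) auto
  qed
  moreover have "\<forall>\<^sub>F x in at_top. (\<integral>t. w (t / x) * (r * fejer (r * (x - t))) \<partial>lborel) =
     x powr (1 - j) * (\<integral>t. indicator {0..} t * t powr (j - 1) * exp_gap (t / x) * (r * fejer (r * (x - t))) \<partial>lborel)"
    using eventually_gt_at_top[of "0::real"]
  proof eventually_elim
    case (elim x)
    have "w (t / x) = x powr (1 - j) * (indicator {0..} t * t powr (j - 1) * exp_gap (t / x))" for t
    proof (cases "t > 0")
      case True
      have "(t / x) powr (j - 1) = x powr (1 - j) * t powr (j - 1)"
        using True elim by (simp add: powr_divide powr_diff)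
      then show ?thesis using True elim by (simp add: w_def)
    next
      case False
      then have "max 0 (t / x) = 0" using elim by (simp add: divide_nonpos_pos)
      then show ?thesis using False by (simp add: w_def indicator_def)
    qed
    then show ?case
      by (simp only: mult.assoc integral_mult_right_zero)
  qed
  ultimately show ?thesis
    by (auto simp: w_def elim: Lim_transform_eventually)
qed

section \<open>Assembly: slow oscillation, absolute convergence, and the limit of the
  averages\<close>

theorem theorem2:
  fixes \<phi> :: "real \<Rightarrow> real" and \<mu> \<nu> j :: real and F H :: "complex \<Rightarrow> complex"
  assumes "\<forall>t\<ge>0. \<phi> t \<ge> 0"
    and "antimono_on {0..} \<phi>"
    and "\<mu> > 0" and "\<nu> > 0"
    and "mono_on {0..} (\<lambda>t. exp (\<nu> * t) * \<phi> t)"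
    and "\<forall>z. 0 < Re z \<and> Re z < \<mu> \<longrightarrow>
           RS_converges_on_halfline (\<lambda>t. exp (z * complex_of_real t)) \<phi>"
    and "j > 0"
    and "\<exists>U. open U \<and> {z. 0 < Re z \<and> Re z \<le> \<mu>} \<subseteq> U \<and> H holomorphic_on U"
    and "F holomorphic_on {z. 0 < Re z \<and> Re z < \<mu>}"
    and "continuous_on {z. 0 < Re z \<and> Re z \<le> \<mu>} F"
    and "\<forall>z. 0 < Re z \<and> Re z < \<mu> \<longrightarrow>
           has_halfline_integral (\<lambda>t. exp (z * complex_of_real t) * complex_of_real (\<phi> t))
             (F z / (complex_of_real \<mu> - z) powr complex_of_real j + H z)"
    and "\<forall>T>0. ((\<lambda>\<sigma>. g_weight j \<sigma> *
             (SUP \<tau>\<in>{-T..T}.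
                cmod (F (complex_of_real (\<mu> - 2 * \<sigma>) - \<i> * complex_of_real \<tau>)
                    - F (complex_of_real (\<mu> - \<sigma>) - \<i> * complex_of_real \<tau>))))
           \<longlongrightarrow> 0) (at_right 0)"
  shows "((\<lambda>t. complex_of_real (\<phi> t * t powr (1 - j) * exp (\<mu> * t)))
           \<longlongrightarrow> F (complex_of_real \<mu>) / complex_of_real (Gamma j)) at_top"
proof -
  note \<phi>0 = assms(1) and anti = assms(2) and \<mu> = assms(3) and \<nu> = assms(4) and mono = assms(5)
    and j = assms(7) and H = assms(8) and Fcont = assms(10) and transform = assms(11) and gap = assms(12)
  define p where "p t = indicator {0..} t * (exp (\<mu> * t) * \<phi> t)" for t
  define G where "G s = F (complex_of_real \<mu> - s)" for s
  define h where "h s = H (complex_of_real \<mu> - s)" for s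
  define M where "M s = (G s - G 0) / s powr complex_of_real j + h s" for s
  define a where "a = G 0 / complex_of_real (Gamma j)"
  have \<phi>_meas: "(\<lambda>t. indicator {0..} t * \<phi> t) \<in> borel_measurable borel"
  proof -
    have "mono_on {0..} (\<lambda>t. - \<phi> t)"
      using anti by (auto simp: monotone_on_def)
    then have "(\<lambda>t. - \<phi> t) \<in> borel_measurable (restrict_space borel {0..})"
      by (rule borel_measurable_mono_on_fnc)
    then have "(\<lambda>t. - (- \<phi> t)) \<in> borel_measurable (restrict_space borel {0..})"
      by (rule borel_measurable_uminus)
    then show ?thesis
      by (simp add: borel_measurable_restrict_space_iff)
  qed
  have p_eq: "p t = exp (\<mu> * t) * (indicator {0..} t * \<phi> t)" for t
    by (simp add: p_def)
  have p_meas [measurable]: "p \<in> borel_measurable borel"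
    unfolding p_eq[abs_def] using \<phi>_meas by measurable
  have p0: "0 \<le> p t" for t
    using \<phi>0 by (simp add: p_def indicator_def)
  have p_neg: "p t = 0" if "t < 0" for t
    using that by (simp add: p_def)
  \<comment> \<open>To the right of x the monotonicity of \<open>\<phi>\<close> leaves only the
    growth of the exponential factor, at rate \<open>\<mu>\<close>. To the left the second
    monotonicity hypothesis costs rate \<open>\<nu>\<close>; the sum of the rates covers both
    sides.\<close>
  have osc: "p t \<le> exp ((\<mu> + \<nu>) * \<bar>t - x\<bar>) * p x" if "0 \<le> t" "0 \<le> x" for t x
  proof (cases "x \<le> t")
    case True
    have "\<phi> t \<le> \<phi> x"
      using anti that True by (auto simp: monotone_on_def)
    then have "exp (\<mu> * t) * \<phi> t \<le> (exp (\<mu> * \<bar>t - x\<bar>) * exp (\<mu> * x)) * \<phi> x"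
      using True by (simp add: exp_add[symmetric] algebra_simps)
    also have "\<dots> \<le> (exp ((\<mu> + \<nu>) * \<bar>t - x\<bar>) * exp (\<mu> * x)) * \<phi> x"
      using \<nu> \<phi>0 that by (intro mult_right_mono) (auto simp: mult_right_mono)
    finally show ?thesis
      using that by (simp add: p_def mult.assoc)
  next
    case False
    have "exp (\<nu> * t) * \<phi> t \<le> exp (\<nu> * x) * \<phi> x"
      using mono that False by (auto simp: monotone_on_def)
    then have "exp (- (\<nu> * t)) * (exp (\<nu> * t) * \<phi> t) \<le> exp (- (\<nu> * t)) * (exp (\<nu> * x) * \<phi> x)"
      by (rule mult_left_mono) simp
    moreover have "exp (- (\<nu> * t)) * (exp (\<nu> * t) * \<phi> t) = \<phi> t"
      by (simp add: exp_minus)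
    moreover have "exp (- (\<nu> * t)) * (exp (\<nu> * x) * \<phi> x) = exp (\<nu> * \<bar>t - x\<bar>) * \<phi> x"
    proof -
      have "\<nu> * \<bar>t - x\<bar> = - (\<nu> * t) + \<nu> * x"
        using False by (simp add: algebra_simps)
      then show ?thesis by (simp only: exp_add mult.assoc)
    qed
    ultimately have "\<phi> t \<le> exp (\<nu> * \<bar>t - x\<bar>) * \<phi> x" by simp
    then have "exp (\<mu> * t) * \<phi> t \<le> (exp (\<mu> * \<bar>t - x\<bar>) * exp (\<mu> * x)) * (exp (\<nu> * \<bar>t - x\<bar>) * \<phi> x)"
    proof (rule mult_mono[rotated])
      show "exp (\<mu> * t) \<le> exp (\<mu> * \<bar>t - x\<bar>) * exp (\<mu> * x)"
        using False \<mu> that by (simp add: exp_add[symmetric] algebra_simps)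
    qed (use \<phi>0 that in auto)
    then show ?thesis
      using that by (simp add: p_def exp_add distrib_right mult_ac)
  qed
  have transform': "has_halfline_integral (\<lambda>t. exp ((\<mu> - s) * complex_of_real t) * complex_of_real (\<phi> t))
      (G s / s powr complex_of_real j + h s)" if "0 < Re s" "Re s < \<mu>" for s :: complex
    using transform[rule_format, of "\<mu> - s"] that by (simp add: G_def h_def)
  have p_int_small: "integrable lborel (\<lambda>t. p t * exp (- (\<sigma> * t)))" if "0 < \<sigma>" "\<sigma> < \<mu>" for \<sigma>
  proof -
    let ?g = "\<lambda>t. exp ((\<mu> - \<sigma>) * t) * \<phi> t"
    have "integrable lborel (\<lambda>t. indicator {0..} t * ?g t)"
    proof (rule halfline_integral_nonneg_integrable)
      have "(\<lambda>t. indicator {0..} t * ?g t) = (\<lambda>t. exp ((\<mu> - \<sigma>) * t) * (indicator {0..} t * \<phi> t))"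
        by (simp add: mult_ac)
      then show "(\<lambda>t. indicator {0..} t * ?g t) \<in> borel_measurable borel"
        using \<phi>_meas by simp
      show "has_halfline_integral (\<lambda>t. complex_of_real (?g t))
          (G (of_real \<sigma>) / of_real \<sigma> powr complex_of_real j + h (of_real \<sigma>))"
        using transform'[of "of_real \<sigma>"] that by (simp add: exp_of_real[symmetric])
    qed (use \<phi>0 in auto)
    also have "(\<lambda>t. indicator {0..} t * ?g t) = (\<lambda>t. p t * exp (- (\<sigma> * t)))"
      by (simp add: fun_eq_iff p_def left_diff_distrib exp_diff exp_minus divide_inverse)
    finally show ?thesis .
  qed
  \<comment> \<open>The transform is given only for \<open>\<sigma>\<close> below
    \<open>\<mu>\<close>; stronger damping is dominated by the damping at
    \<open>min \<sigma> (\<mu> / 2)\<close>. This makes the weighted function integrable for every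
    positive x, also when 1/x exceeds \<open>\<mu>\<close>.\<close>
  have p_int: "integrable lborel (\<lambda>t. p t * exp (- (\<sigma> * t)))" if "0 < \<sigma>" for \<sigma>
  proof (rule Bochner_Integration.integrable_bound[OF p_int_small])
    show "AE t in lborel. norm (p t * exp (- (\<sigma> * t))) \<le> norm (p t * exp (- (min \<sigma> (\<mu> / 2) * t)))"
    proof (rule AE_I2)
      fix t :: real
      have "p t * exp (- (\<sigma> * t)) \<le> p t * exp (- (min \<sigma> (\<mu> / 2) * t))"
      proof (cases "0 \<le> t")
        case True
        then show ?thesis
          using p0 by (intro mult_left_mono) (auto intro: mult_right_mono)
      qed (simp add: p_def)
      then show "norm (p t * exp (- (\<sigma> * t))) \<le> norm (p t * exp (- (min \<sigma> (\<mu> / 2) * t)))"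
        using p0 by (simp add: abs_mult)
    qed
  qed (use that \<mu> in auto)
  have gap_exp: "exp_gap (t / x) = exp (- ((1 / x) * t)) - exp (- ((2 / x) * t))" for t x
    by (simp add: exp_gap_def)
  have p_gap_int: "integrable lborel (\<lambda>t. p t * exp_gap (t / x))" if "x > 0" for x
    unfolding gap_exp right_diff_distrib using p_int[of "1 / x"] p_int[of "2 / x"] that
    by (intro Bochner_Integration.integrable_diff) auto
  have p_laplace: "integrable lborel (\<lambda>t. complex_of_real (p t) * exp (- (s * complex_of_real t)))"
      "(\<integral>t. complex_of_real (p t) * exp (- (s * complex_of_real t)) \<partial>lborel) = G s / s powr complex_of_real j + h s"
    if s: "0 < Re s" "Re s < \<mu>" for s
  proof -
    show int: "integrable lborel (\<lambda>t. complex_of_real (p t) * exp (- (s * complex_of_real t)))"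
      by (rule Bochner_Integration.integrable_bound[OF p_int[OF s(1)]])
         (use p0 in \<open>auto simp: norm_mult\<close>)
    have e: "complex_of_real (p t) * exp (- (s * complex_of_real t))
        = indicator {0..} t *\<^sub>R (exp ((\<mu> - s) * complex_of_real t) * complex_of_real (\<phi> t))" for t
      by (simp add: p_def scaleR_conv_of_real left_diff_distrib exp_diff exp_minus divide_inverse exp_of_real[symmetric])
    show "(\<integral>t. complex_of_real (p t) * exp (- (s * complex_of_real t)) \<partial>lborel) = G s / s powr complex_of_real j + h s"
      using halfline_integral_eq_lborel[OF _ transform'[OF s]] int unfolding e by blast
  qed
  have kernel_limit: "((\<lambda>x. x powr (1 - j) * (\<integral>t. p t * exp_gap (t / x) * (r * fejer (r * (x - t))) \<partial>lborel))
      \<longlongrightarrow> Re a * exp_gap 1 * fejer_mass) at_top" and a_real: "Im a = 0" if r: "r > 0" for r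
  proof -
    define Jp where "Jp x = (\<integral>t. p t * exp_gap (t / x) * (r * fejer (r * (x - t))) \<partial>lborel)" for x
    define J0 where "J0 x = (\<integral>t. indicator {0..} t * t powr (j - 1) * exp_gap (t / x) * (r * fejer (r * (x - t))) \<partial>lborel)" for x
    define q where "q \<sigma> u = indicator {-r..r} u *\<^sub>R (complex_of_real (1 - \<bar>u\<bar> / r) * cis (u * inverse \<sigma>) *
        (M (Complex \<sigma> u) - M (Complex (2 * \<sigma>) u)))" for \<sigma> u
    have "((\<lambda>\<sigma>. \<sigma> powr (j - 1) * cmod (\<integral>u. q \<sigma> u \<partial>lborel)) \<longlongrightarrow> 0) (at_right 0)"
    proof -
      \<comment> \<open>Taking half the strip keeps real parts at least \<open>\<mu> / 2\<close>,
        inside the region where \<open>F\<close> and \<open>H\<close> are controlled. The reflection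
        s to \<open>\<mu>\<close> - s carries the box of the boundary lemma onto
        \<open>?K\<close>.\<close>
      let ?K = "cbox (Complex (\<mu> / 2) (-r)) (Complex \<mu> r)"
      obtain U where U: "open U" "{z. 0 < Re z \<and> Re z \<le> \<mu>} \<subseteq> U" "H holomorphic_on U"
        using H by blast
      have "?K \<subseteq> U"
        using U(2) \<mu> by (auto simp: in_cbox_complex_iff)
      then obtain L where L: "L \<ge> 0" "\<And>x y. x \<in> ?K \<Longrightarrow> y \<in> ?K \<Longrightarrow> cmod (H x - H y) \<le> L * cmod (x - y)"
        using holomorphic_lipschitz_on_compact_convex[OF U(3,1) compact_cbox convex_box(1)] by metis
      show ?thesis
      proof (rule boundary_difference_limit[where G = G and h = h and d = "\<mu> / 2" and r = r and L = L])
        show "continuous_on {s. 0 \<le> Re s \<and> Re s \<le> \<mu> / 2} G"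
          unfolding G_def
          by (rule continuous_on_compose2[OF Fcont]) (use \<mu> in \<open>auto intro!: continuous_intros\<close>)
        fix s s' assume "s \<in> cbox (Complex 0 (-r)) (Complex (\<mu> / 2) r)" "s' \<in> cbox (Complex 0 (-r)) (Complex (\<mu> / 2) r)"
        then have "of_real \<mu> - s \<in> ?K" "of_real \<mu> - s' \<in> ?K"
          by (auto simp: in_cbox_complex_iff)
        from L(2)[OF this] show "cmod (h s - h s') \<le> L * cmod (s - s')"
          by (simp add: h_def norm_minus_commute)
      next
        have "complex_of_real (\<mu> - c) - \<i> * complex_of_real \<tau> = complex_of_real \<mu> - Complex c \<tau>" for c \<tau>
          by (simp add: complex_eq_iff)
        then show "((\<lambda>\<sigma>. g_weight j \<sigma> * (SUP t\<in>{-r..r}. cmod (G (Complex (2 * \<sigma>) t) - G (Complex \<sigma> t)))) \<longlongrightarrow> 0) (at_right 0)"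
          using gap[rule_format, OF r] by (simp only: G_def)
      next
        fix \<sigma> t
        show "cmod (q \<sigma> t) \<le> indicator {-r..r} t * cmod ((G (Complex \<sigma> t) - G 0) / Complex \<sigma> t powr complex_of_real j + h (Complex \<sigma> t)
            - ((G (Complex (2 * \<sigma>) t) - G 0) / Complex (2 * \<sigma>) t powr complex_of_real j + h (Complex (2 * \<sigma>) t)))"
        proof (cases "t \<in> {-r..r}")
          case True
          have "\<bar>t\<bar> / r \<le> 1" "0 \<le> \<bar>t\<bar> / r" using True r by auto
          then have "cmod (complex_of_real (1 - \<bar>t\<bar> / r)) \<le> 1"
            unfolding norm_of_real by simp
          then show ?thesis
            using True by (simp add: q_def M_def norm_mult mult_left_le_one_le del: of_real_diff)
        qed (simp add: q_def)
      qed (use j \<mu> r L in auto)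
    qed
    then have "((\<lambda>x. inverse x powr (j - 1) * cmod (\<integral>u. q (inverse x) u \<partial>lborel)) \<longlongrightarrow> 0) at_top"
      by (rule filterlim_compose[OF _ filterlim_inverse_at_right_top])
    moreover have "\<forall>\<^sub>F x in at_top. inverse x powr (j - 1) * cmod (\<integral>u. q (inverse x) u \<partial>lborel)
        = cmod (complex_of_real (x powr (1 - j) * Jp x) - a * complex_of_real (x powr (1 - j) * J0 x))"
      using eventually_gt_at_top[of "2 / \<mu>"] eventually_gt_at_top[of "0::real"]
    proof eventually_elim
      case (elim x)
      let ?\<sigma> = "inverse x"
      let ?g = "\<lambda>t. (complex_of_real (p t) - a * complex_of_real (indicator {0..} t * t powr (j - 1))) * complex_of_real (exp_gap (t / x))"
      let ?e = "\<lambda>s t. exp (- (s * complex_of_real t))"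
      let ?p0 = "\<lambda>t. complex_of_real (indicator {0..} t * t powr (j - 1))"
      have \<sigma>: "0 < ?\<sigma>" "2 * ?\<sigma> < \<mu>"
        using elim \<mu> by (auto simp: field_simps)
      have pow: "integrable lborel (\<lambda>t. ?p0 t * ?e s t)"
          "(\<integral>t. ?p0 t * ?e s t \<partial>lborel) = complex_of_real (Gamma j) / s powr complex_of_real j" if "0 < Re s" for s
        using laplace_powr[OF j that] by (simp_all add: scaleR_conv_of_real mult.assoc)
      \<comment> \<open>The constant \<open>a\<close> is chosen so that subtracting the power's
        transform replaces \<open>G s\<close> by \<open>G s - G 0\<close> in the singular
        quotient.\<close>
      have M_int: "has_bochner_integral lborel (\<lambda>t. complex_of_real (p t) * ?e s t - a * (?p0 t * ?e s t)) (M s)"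
        if "0 < Re s" "Re s < \<mu>" for s
      proof -
        have "has_bochner_integral lborel (\<lambda>t. complex_of_real (p t) * ?e s t - a * (?p0 t * ?e s t))
            (G s / s powr complex_of_real j + h s - a * (complex_of_real (Gamma j) / s powr complex_of_real j))"
          using p_laplace[OF that] pow[OF that(1)]
          by (intro has_bochner_integral_diff has_bochner_integral_mult_right) (simp_all add: has_bochner_integral_iff)
        also have "G s / s powr complex_of_real j + h s - a * (complex_of_real (Gamma j) / s powr complex_of_real j) = M s"
          using Gamma_real_pos[OF j] by (simp add: M_def a_def diff_divide_distrib)
        finally show ?thesis .
      qed
      \<comment> \<open>The damping combines with \<open>cis (- (u * t))\<close> into exponentials
        at \<open>Complex ?\<sigma> u\<close> and \<open>Complex (2 * ?\<sigma>) u\<close>, so the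
        Fourier transform of the weighted difference is a difference of two values of
        \<open>M\<close>.\<close>
      have g_cis: "has_bochner_integral lborel (\<lambda>t. ?g t * cis (- (u * t))) (M (Complex ?\<sigma> u) - M (Complex (2 * ?\<sigma>) u))" for u
      proof -
        have "?e (Complex c u) t = complex_of_real (exp (- (c * t))) * cis (- (u * t))" for c t
          by (simp add: exp_eq_polar complex_eq_iff cis.ctr Re_exp Im_exp)
        moreover have "exp_gap (t / x) = exp (- (?\<sigma> * t)) - exp (- ((2 * ?\<sigma>) * t))" for t
          by (simp add: exp_gap_def divide_inverse mult_ac)
        ultimately have "?g t * cis (- (u * t)) = (complex_of_real (p t) * ?e (Complex ?\<sigma> u) t - a * (?p0 t * ?e (Complex ?\<sigma> u) t))
            - (complex_of_real (p t) * ?e (Complex (2 * ?\<sigma>) u) t - a * (?p0 t * ?e (Complex (2 * ?\<sigma>) u) t))" for t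
          by (simp only: of_real_diff) (simp only: algebra_simps)
        then show ?thesis
          using has_bochner_integral_diff[OF M_int[of "Complex ?\<sigma> u"] M_int[of "Complex (2 * ?\<sigma>) u"]] \<sigma> by simp
      qed
      have "integrable lborel ?g"
        using g_cis[of 0, THEN integrable.intros] by (simp add: cis_zero)
      from fejer_fubini[OF this r, of x]
      have "(\<integral>t. ?g t * complex_of_real (r * fejer (r * (x - t))) \<partial>lborel) = (\<integral>u. q ?\<sigma> u \<partial>lborel)"
        by (simp only: has_bochner_integral_integral_eq[OF g_cis] q_def inverse_inverse_eq)
      moreover have "(\<integral>t. ?g t * complex_of_real (r * fejer (r * (x - t))) \<partial>lborel) = complex_of_real (Jp x) - a * complex_of_real (J0 x)"
      proof -
        let ?k = "\<lambda>t. r * fejer (r * (x - t))"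
        have i1: "integrable lborel (\<lambda>t. p t * exp_gap (t / x) * ?k t)"
          using elim r by (intro fejer_shift_mult_integrable p_gap_int)
        have i2: "integrable lborel (\<lambda>t. indicator {0..} t * t powr (j - 1) * exp_gap (t / x) * ?k t)"
        proof (intro fejer_shift_mult_integrable r)
          have "indicator {0..} t * t powr (j - 1) * exp_gap (t / x) = indicator {0..} t * (t powr (j - 1) * exp (- ((1 / x) * t)))
              - indicator {0..} t * (t powr (j - 1) * exp (- ((2 / x) * t)))" for t
            unfolding gap_exp by (simp only: algebra_simps)
          moreover have "integrable lborel (\<lambda>t. indicator {0..} t * (t powr (j - 1) * exp (- ((c / x) * t))))" if "c > 0" for c
            by (rule has_bochner_integral_Gamma_scaled[OF j, THEN integrable.intros]) (use that elim in simp)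
          ultimately show "integrable lborel (\<lambda>t. indicator {0..} t * t powr (j - 1) * exp_gap (t / x))"
            by (simp only: Bochner_Integration.integrable_diff zero_less_one zero_less_numeral)
        qed
        have "?g t * complex_of_real (?k t) = complex_of_real (p t * exp_gap (t / x) * ?k t)
            - a * complex_of_real (indicator {0..} t * t powr (j - 1) * exp_gap (t / x) * ?k t)" for t
          by (simp only: of_real_mult left_diff_distrib mult.assoc)
        then have "(\<integral>t. ?g t * complex_of_real (?k t) \<partial>lborel)
           = (\<integral>t. complex_of_real (p t * exp_gap (t / x) * ?k t) \<partial>lborel)
            - (\<integral>t. a * complex_of_real (indicator {0..} t * t powr (j - 1) * exp_gap (t / x) * ?k t) \<partial>lborel)"
          using i1 i2 by (simp only: Bochner_Integration.integral_diff integrable_mult_right integrable_of_real)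
        then show ?thesis
          unfolding Jp_def J0_def by (simp only: integral_mult_right_zero integral_complex_of_real)
      qed
      moreover have "inverse x powr (j - 1) = x powr (1 - j)"
        using elim by (simp add: inverse_eq_divide powr_divide powr_diff)
      ultimately have "inverse x powr (j - 1) * cmod (\<integral>u. q ?\<sigma> u \<partial>lborel)
          = cmod (complex_of_real (x powr (1 - j)) * (complex_of_real (Jp x) - a * complex_of_real (J0 x)))"
        by (simp add: norm_mult)
      then show ?case
        by (simp add: algebra_simps)
    qed
    ultimately have "((\<lambda>x. cmod (complex_of_real (x powr (1 - j) * Jp x) - a * complex_of_real (x powr (1 - j) * J0 x))) \<longlongrightarrow> 0) at_top"
      by (rule Lim_transform_eventually)
    then have "((\<lambda>x. complex_of_real (x powr (1 - j) * Jp x) - a * complex_of_real (x powr (1 - j) * J0 x)) \<longlongrightarrow> 0) at_top"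
      by (rule tendsto_norm_zero_cancel)
    moreover have "((\<lambda>x. a * complex_of_real (x powr (1 - j) * J0 x)) \<longlongrightarrow> a * complex_of_real (exp_gap 1 * fejer_mass)) at_top"
      unfolding J0_def by (intro tendsto_intros powr_kernel_limit j r)
    ultimately have lim: "((\<lambda>x. complex_of_real (x powr (1 - j) * Jp x)) \<longlongrightarrow> a * complex_of_real (exp_gap 1 * fejer_mass)) at_top"
      using tendsto_add by fastforce
    from tendsto_Re[OF lim] show "((\<lambda>x. x powr (1 - j) * (\<integral>t. p t * exp_gap (t / x) * (r * fejer (r * (x - t))) \<partial>lborel))
      \<longlongrightarrow> Re a * exp_gap 1 * fejer_mass) at_top"
      by (simp add: Jp_def mult.assoc)
    \<comment> \<open>The averages of \<open>p\<close> are real, so their limit has zero imaginary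
      part. This shows that F(\<open>\<mu>\<close>) is real, which is not assumed.\<close>
    have "((\<lambda>x. 0) \<longlongrightarrow> Im (a * complex_of_real (exp_gap 1 * fejer_mass))) (at_top :: real filter)"
      using tendsto_Im[OF lim] by simp
    then have "Im (a * complex_of_real (exp_gap 1 * fejer_mass)) = 0"
      by (simp add: tendsto_const_iff)
    then show "Im a = 0"
      using exp_gap_pos fejer_mass_pos by simp
  qed
  obtain B where B: "\<And>v. 0 < v \<Longrightarrow> v powr (j - 1) * exp_gap v \<le> B"
    using powr_exp_gap_bounded[OF j] by blast
  have "((\<lambda>x. p x * x powr (1 - j)) \<longlongrightarrow> Re a) at_top"
    by (rule fejer_tauberian[where M = "\<mu> + \<nu>" and W = exp_gap and B = B])
       (use p_meas p0 p_neg osc \<mu> \<nu> j B kernel_limit p_gap_int exp_gap_nonneg exp_gap_le exp_gap_pos isCont_exp_gap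
         in auto)
  then have "((\<lambda>x. complex_of_real (p x * x powr (1 - j))) \<longlongrightarrow> complex_of_real (Re a)) at_top"
    by (rule tendsto_of_real)
  also have "complex_of_real (Re a) = F (complex_of_real \<mu>) / complex_of_real (Gamma j)"
    using a_real[of 1] by (simp add: complex_eq_iff a_def G_def)
  finally show ?thesis
  proof (rule Lim_transform_eventually)
    show "\<forall>\<^sub>F x in at_top. complex_of_real (p x * x powr (1 - j)) = complex_of_real (\<phi> x * x powr (1 - j) * exp (\<mu> * x))"
      using eventually_ge_at_top[of "0::real"] by eventually_elim (simp add: p_def)
  qed
qed

end
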